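(* Let $\Sigma=(\sigma_{ij})_{0\le i,j\le d}$ be the covariance matrix of a $(d+1)$-dimensional mean-zero Brownian motion $B(t)=(B_0(t),B_1(t),\dots,B_d(t))'$, let $\hat B(t)=(B_1(t),\dots,B_d(t))'$, and let $Z=(Z_0,Z_1,\dots,Z_d)'$ be a mean-zero multivariate normal vector with covariance matrix $\Sigma$, $\hat Z=(Z_1,\dots,Z_d)'$. Let $\mathcal A=\mathrm{Cov}(Z_0\hat Z)$ and $\mathcal C=\mathrm{Cov}(\mathcal I)$ be the $d\times d$ covariance matrices of the random vectors $Z_0\hat Z$ and $$\mathcal I=\int_0^1(B_0(1)-B_0(s))\,d\hat B(s):=B_0(1)\hat B(1)-\int_0^1B_0(s)\,d\hat B(s)$$ (the last integral being an It\^o integral). If $\mathcal C$ is positive definite, then $$\det(\mathcal A)\ge2^d\det(\mathcal C).$$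
   Context: A (mean-zero) Brownian motion with covariance matrix $\Sigma$ starts at $B(0)=0$ and has $\mathrm{Cov}(B(t))=t\Sigma$; $'$ denotes transpose. ($\mathcal A$ and $\mathcal C$ are the asymptotic covariance matrices of the two gradient estimators compared in the source.) *)

theory Defs
  imports "HOL-Probability.Probability"
begin

section \<open>Random vectors\<close>

definition cov_matrix :: "'a measure \<Rightarrow> ('a \<Rightarrow> real^'k) \<Rightarrow> real^'k^'k" where
  "cov_matrix M X = (\<chi> i j.
     \<integral>\<omega>. (X \<omega> $ i - (\<integral>x. X x $ i \<partial>M)) * (X \<omega> $ j - (\<integral>x. X x $ j \<partial>M)) \<partial>M)"

definition positive_definite :: "real^'k^'k \<Rightarrow> bool" where
  "positive_definite S \<longleftrightarrow> transpose S = S \<and> (\<forall>x. x \<noteq> 0 \<longrightarrow> x \<bullet> (S *v x) > 0)"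

text \<open>Covariance matrices may be singular, so point masses count as normal laws.\<close>

definition normal_rv :: "'a measure \<Rightarrow> ('a \<Rightarrow> real) \<Rightarrow> bool" where
  "normal_rv M X \<longleftrightarrow> X \<in> borel_measurable M \<and>
     ((\<exists>\<mu> \<sigma>. \<sigma> > 0 \<and> distributed M lborel X (normal_density \<mu> \<sigma>)) \<or>
      (\<exists>\<mu>. AE \<omega> in M. X \<omega> = \<mu>))"

definition multivariate_normal :: "'a measure \<Rightarrow> ('a \<Rightarrow> real^'k) \<Rightarrow> bool" where
  "multivariate_normal M X \<longleftrightarrow>
     X \<in> borel_measurable M \<and> (\<forall>u. normal_rv M (\<lambda>\<omega>. u \<bullet> X \<omega>))"

definition mean_zero_normal :: "'a measure \<Rightarrow> real^'k^'k \<Rightarrow> ('a \<Rightarrow> real^'k) \<Rightarrow> bool" where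
  "mean_zero_normal M S X \<longleftrightarrow>
     multivariate_normal M X \<and> (\<forall>i. (\<integral>\<omega>. X \<omega> $ i \<partial>M) = 0) \<and> cov_matrix M X = S"

section \<open>Brownian motion\<close>

text \<open>Processes are indexed by the reals, but only their values at times \<open>t \<ge> 0\<close> matter.\<close>

definition natural_filtration ::
    "'a measure \<Rightarrow> (real \<Rightarrow> 'a \<Rightarrow> 'b::topological_space) \<Rightarrow> real \<Rightarrow> 'a measure" where
  "natural_filtration M X t =
     sigma (space M) {X s -` A \<inter> space M | s A. 0 \<le> s \<and> s \<le> t \<and> A \<in> sets borel}"

locale brownian_motion = prob_space M
  for M :: "'a measure" and S :: "real^'k^'k" and B :: "real \<Rightarrow> 'a \<Rightarrow> real^'k" +
  assumes measurable_B: "0 \<le> t \<Longrightarrow> B t \<in> borel_measurable M"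
    and start: "AE \<omega> in M. B 0 \<omega> = 0"
    and continuous_paths: "\<omega> \<in> space M \<Longrightarrow> continuous_on {0..} (\<lambda>t. B t \<omega>)"
    and normal_increments:
      "0 \<le> s \<Longrightarrow> s \<le> t \<Longrightarrow> mean_zero_normal M ((t - s) *\<^sub>R S) (\<lambda>\<omega>. B t \<omega> - B s \<omega>)"
    and independent_increments:
      "0 \<le> s \<Longrightarrow> s \<le> t \<Longrightarrow>
         indep_set (sets (natural_filtration M B s))
           {(\<lambda>\<omega>. B t \<omega> - B s \<omega>) -` A \<inter> space M | A. A \<in> sets borel}"

section \<open>The Ito integral\<close>

text \<open>
  A simple process on \<open>(0, T]\<close> is \<open>\<Sum>k<n. \<xi> k * indicator {\<tau> k <.. \<tau> (Suc k)}\<close> with bounded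
  coefficients \<open>\<xi> k\<close> that are known at time \<open>\<tau> k\<close>.
\<close>

definition simple_process ::
    "'a measure \<Rightarrow> (real \<Rightarrow> 'a measure) \<Rightarrow> real \<Rightarrow> nat \<Rightarrow> (nat \<Rightarrow> real) \<Rightarrow> (nat \<Rightarrow> 'a \<Rightarrow> real) \<Rightarrow> bool"
  where
  "simple_process M F T n \<tau> \<xi> \<longleftrightarrow>
     \<tau> 0 = 0 \<and> \<tau> n = T \<and> (\<forall>k<n. \<tau> k < \<tau> (Suc k)) \<and>
     (\<forall>k<n. \<xi> k \<in> borel_measurable (F (\<tau> k)) \<and> (\<exists>c. \<forall>\<omega>\<in>space M. \<bar>\<xi> k \<omega>\<bar> \<le> c))"

definition simple_value ::
    "nat \<Rightarrow> (nat \<Rightarrow> real) \<Rightarrow> (nat \<Rightarrow> 'a \<Rightarrow> real) \<Rightarrow> real \<Rightarrow> 'a \<Rightarrow> real" where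
  "simple_value n \<tau> \<xi> s \<omega> = (\<Sum>k<n. \<xi> k \<omega> * indicator {\<tau> k<..\<tau> (Suc k)} s)"

definition simple_integral ::
    "nat \<Rightarrow> (nat \<Rightarrow> real) \<Rightarrow> (nat \<Rightarrow> 'a \<Rightarrow> real) \<Rightarrow> (real \<Rightarrow> 'a \<Rightarrow> real) \<Rightarrow> 'a \<Rightarrow> real" where
  "simple_integral n \<tau> \<xi> W \<omega> = (\<Sum>k<n. \<xi> k \<omega> * (W (\<tau> (Suc k)) \<omega> - W (\<tau> k) \<omega>))"

text \<open>
  \<open>has_ito_integral M F W T H J\<close> says that the random variable \<open>J\<close> is a version of the Ito integral
  of \<open>H\<close> against \<open>W\<close> over \<open>[0, T]\<close>: it is the mean-square limit of the integrals of simple processes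
  that converge to \<open>H\<close> in mean square over \<open>[0, T] \<times> space M\<close>. The intended \<open>W\<close> is a real-valued
  (possibly rescaled or identically zero) Brownian motion relative to the filtration \<open>F\<close>; the Ito
  isometry then makes \<open>J\<close> unique up to null sets.
\<close>

definition has_ito_integral ::
    "'a measure \<Rightarrow> (real \<Rightarrow> 'a measure) \<Rightarrow> (real \<Rightarrow> 'a \<Rightarrow> real) \<Rightarrow> real \<Rightarrow>
     (real \<Rightarrow> 'a \<Rightarrow> real) \<Rightarrow> ('a \<Rightarrow> real) \<Rightarrow> bool" where
  "has_ito_integral M F W T H J \<longleftrightarrow>
     (\<forall>s\<in>{0..T}. H s \<in> borel_measurable (F s)) \<and>
     (\<lambda>(s, \<omega>). H s \<omega>) \<in> borel_measurable (restrict_space lborel {0..T} \<Otimes>\<^sub>M M) \<and>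
     J \<in> borel_measurable M \<and>
     (\<exists>n \<tau> \<xi>. (\<forall>m. simple_process M F T (n m) (\<tau> m) (\<xi> m)) \<and>
        (\<lambda>m. \<integral>\<^sup>+\<omega>. (\<integral>\<^sup>+s\<in>{0..T}. ennreal ((simple_value (n m) (\<tau> m) (\<xi> m) s \<omega> - H s \<omega>)\<^sup>2) \<partial>lborel) \<partial>M)
          \<longlonglongrightarrow> 0 \<and>
        (\<lambda>m. \<integral>\<^sup>+\<omega>. ennreal ((simple_integral (n m) (\<tau> m) (\<xi> m) W \<omega> - J \<omega>)\<^sup>2) \<partial>M) \<longlonglongrightarrow> 0)"

end

theory Submission
  imports Defs
begin

text \<open>
  Write \<open>v\<close> for the vector of covariances \<open>\<Sigma>\<^sub>0\<^sub>i\<close>. Both covariance matrices are quadratic in \<open>\<Sigma>\<close>: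
  Gaussian moments give \<open>A = \<Sigma>\<^sub>0\<^sub>0 \<Sigma>' + v v\<^sup>T\<close>, where \<open>\<Sigma>'\<close> is the block of \<open>\<Sigma>\<close> belonging to the last
  \<open>d\<close> coordinates, while for the remainder \<open>I\<close> the rank-one part cancels and \<open>C = \<Sigma>\<^sub>0\<^sub>0 \<Sigma>' / 2\<close>.
  Hence \<open>A = 2 C + v v\<^sup>T\<close>, and adding a rank-one positive semidefinite matrix to the positive
  definite matrix \<open>2 C\<close> does not decrease its determinant (\<open>det_add_outer\<close>), so
  \<open>det A \<ge> det (2 C) = 2\<^sup>d det C\<close>.

  The matrix \<open>C\<close> is computed without an Ito formula. Its entries involve the Ito integrals
  \<open>J\<^sub>i = \<integral> B\<^sub>0 dB\<^sub>i\<close> only through \<open>E J\<^sub>i\<close>, \<open>E (J\<^sub>i J\<^sub>j)\<close> and \<open>E (J\<^sub>i B\<^sub>0(1) B\<^sub>j(1))\<close>. For the integral of a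
  single step \<open>\<xi> 1\<^bsub>(a,b]\<^esub>\<close> these expectations follow from the independence of the increments and the
  vanishing of Gaussian third moments (\<open>elementary_isometry\<close>, \<open>elementary_integral_times_product\<close>),
  and each turns out to be a bilinear expression in inner products of integrands over
  \<open>[0, 1] \<times> \<Omega>\<close>. Such expressions survive summation over the steps and mean-square limits
  (\<open>mean_square_limit_inner\<close>), so for \<open>J\<^sub>i\<close> it remains to insert
  \<open>\<integral> E (B\<^sub>k(s) B\<^sub>l(s)) ds = \<Sigma>\<^sub>k\<^sub>l / 2\<close>.
\<close>

section \<open>Determinants of positive definite matrices\<close>

lemma det_nonzero_if_kernel_trivial:
  fixes P :: "real^'n^'n"
  assumes "\<And>x. x \<noteq> 0 \<Longrightarrow> P *v x \<noteq> 0"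
  shows "det P \<noteq> 0"
proof -
  have "\<exists>Q. Q ** P = mat 1"
    using assms by (subst matrix_left_invertible_ker) blast
  then show ?thesis
    by (simp add: invertible_det_nz[symmetric] invertible_left_inverse)
qed

text \<open>
  The segment from the identity to \<open>P\<close> stays inside the matrices with positive quadratic form, where
  the determinant cannot vanish; so it keeps the sign it has at the identity.
\<close>

lemma det_pos_if_quadratic_form_pos:
  fixes P :: "real^'n^'n"
  assumes "\<And>x. x \<noteq> 0 \<Longrightarrow> x \<bullet> (P *v x) > 0"
  shows "det P > 0"
proof (rule ccontr)
  define g where "g t = det ((1 - t) *\<^sub>R mat 1 + t *\<^sub>R P)" for t :: real
  assume "\<not> det P > 0"
  then have "g 1 \<le> 0" "g 0 > 0"
    by (auto simp: g_def det_I)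
  moreover have "continuous_on {0..1} g"
    unfolding g_def det_def by (intro continuous_intros)
  ultimately obtain t where t: "0 \<le> t" "t \<le> 1" "g t = 0"
    using IVT2'[of g 1 0 0] by auto
  have "((1 - t) *\<^sub>R mat 1 + t *\<^sub>R P) *v x \<noteq> 0" if "x \<noteq> 0" for x
  proof
    assume "((1 - t) *\<^sub>R mat 1 + t *\<^sub>R P) *v x = 0"
    then have "x \<bullet> (((1 - t) *\<^sub>R mat 1 + t *\<^sub>R P) *v x) = 0"
      by simp
    then have "(1 - t) * (x \<bullet> x) + t * (x \<bullet> (P *v x)) = 0"
      by (simp add: matrix_vector_mult_add_rdistrib inner_add_right scaleR_matrix_vector_assoc[symmetric])
    moreover have "(1 - t) * (x \<bullet> x) \<ge> 0" "t * (x \<bullet> (P *v x)) \<ge> 0"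
      using t assms[OF that] by auto
    moreover have "(1 - t) * (x \<bullet> x) > 0 \<or> t * (x \<bullet> (P *v x)) > 0"
      using t that assms[OF that] by (cases "t = 1") auto
    ultimately show False
      by linarith
  qed
  then show False
    using det_nonzero_if_kernel_trivial t(3) unfolding g_def by blast
qed

definition outer_product :: "real^'n \<Rightarrow> real^'n^'n" where
  "outer_product v = (\<chi> i j. v $ i * v $ j)"

lemma outer_mult_vec: "outer_product v *v x = (v \<bullet> x) *\<^sub>R v"
  by (simp add: outer_product_def vec_eq_iff matrix_vector_mult_def inner_vec_def sum_distrib_left
      sum_distrib_right mult_ac)

lemma conj_outer: "R ** outer_product v ** transpose R = outer_product (R *v v)"
proof -
  have "(R ** outer_product v ** transpose R) *v x = outer_product (R *v v) *v x" for x
    by (simp add: matrix_vector_mul_assoc[symmetric] outer_mult_vec matrix_vector_mult_scaleR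
        dot_lmul_matrix[symmetric] matrix_transpose_mul inner_commute transpose_matrix_vector)
  then show ?thesis
    by (simp add: matrix_eq)
qed

text \<open>
  By linearity of the determinant in row \<open>k\<close>, adding \<open>a\<^sup>2\<close> to the diagonal entry \<open>k\<close> changes the
  determinant by an amount proportional to \<open>a\<^sup>2\<close>. The determinant stays positive for every \<open>a\<close>, so the
  constant of proportionality cannot be negative.
\<close>

lemma det_add_outer_axis:
  fixes P :: "real^'n^'n"
  assumes P: "\<And>x. x \<noteq> 0 \<Longrightarrow> x \<bullet> (P *v x) > 0"
  shows "det P \<le> det (P + outer_product (c *\<^sub>R axis k 1))"
proof -
  define D where "D = det (\<chi> i. if i = k then axis k 1 else row i P)"
  have affine: "det (P + outer_product (a *\<^sub>R axis k 1)) = det P + a\<^sup>2 * D" for a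
  proof -
    have "P + outer_product (a *\<^sub>R axis k 1) = (\<chi> i. if i = k then row k P + a\<^sup>2 *s axis k 1 else row i P)"
      by (auto simp: vec_eq_iff outer_product_def axis_def row_def power2_eq_square)
    moreover have "P = (\<chi> i. if i = k then row k P else row i P)"
      by (auto simp: vec_eq_iff row_def)
    ultimately show ?thesis
      unfolding D_def using det_row_add[of k "\<lambda>_. row k P" "\<lambda>_. a\<^sup>2 *s axis k 1" "\<lambda>i. row i P"]
        det_row_mul[of k "a\<^sup>2" "\<lambda>_. axis k 1" "\<lambda>i. row i P"] by simp
  qed
  have "det P + a\<^sup>2 * D > 0" for a
  proof -
    have "det (P + outer_product (a *\<^sub>R axis k 1)) > 0"
    proof (rule det_pos_if_quadratic_form_pos)
      fix x :: "real^'n" assume "x \<noteq> 0"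
      have "x \<bullet> ((P + outer_product (a *\<^sub>R axis k 1)) *v x)
          = x \<bullet> (P *v x) + (x \<bullet> (a *\<^sub>R axis k 1))\<^sup>2"
        by (simp only: matrix_vector_mult_add_rdistrib inner_add_right outer_mult_vec
            inner_scaleR_right inner_commute power2_eq_square)
      then show "x \<bullet> ((P + outer_product (a *\<^sub>R axis k 1)) *v x) > 0"
        using P[OF \<open>x \<noteq> 0\<close>] by (simp add: add_pos_nonneg)
    qed
    then show ?thesis by (simp add: affine)
  qed
  note pos = this
  have "D \<ge> 0"
  proof (rule ccontr)
    assume "\<not> D \<ge> 0"
    moreover have "det P > 0" using pos[of 0] by simp
    \<comment> \<open>the root of the affine function of \<open>a\<^sup>2\<close>\<close>
    ultimately have "(sqrt (det P / - D))\<^sup>2 * D = - det P"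
      by (simp add: divide_nonneg_pos field_simps)
    with pos[of "sqrt (det P / - D)"] show False by simp
  qed
  then show ?thesis by (simp add: affine)
qed

text \<open>
  An orthogonal change of coordinates turns \<open>v\<close> into a multiple of a basis vector.
\<close>

lemma det_add_outer:
  fixes P :: "real^'n^'n"
  assumes P: "\<And>x. x \<noteq> 0 \<Longrightarrow> x \<bullet> (P *v x) > 0"
  shows "det P \<le> det (P + outer_product v)"
proof -
  fix k :: 'n
  obtain f :: "real^'n \<Rightarrow> real^'n" where f: "orthogonal_transformation f" "f v = norm v *\<^sub>R axis k 1"
    using orthogonal_transformation_exists[of v "norm v *\<^sub>R axis k 1"] by auto
  define R where "R = matrix f"
  have R: "orthogonal_matrix R" and Rv: "R *v v = norm v *\<^sub>R axis k 1"
    using f orthogonal_transformation_matrix[of f] matrix_works[of f]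
    by (auto simp: R_def linear_matrix_vector_mul_eq)
  have det_conj: "det (R ** X ** transpose R) = det X" for X
    using det_orthogonal_matrix[OF R] by (auto simp: det_mul det_transpose)
  have "x \<bullet> (R ** P ** transpose R *v x) > 0" if "x \<noteq> 0" for x
  proof -
    have "R *v (transpose R *v x) = x"
      using R by (simp add: matrix_vector_mul_assoc orthogonal_matrix_def del: transpose_matrix_vector)
    then have "transpose R *v x \<noteq> 0" using that by auto
    from P[OF this] show ?thesis
      by (simp add: matrix_vector_mul_assoc[symmetric] transpose_matrix_vector dot_lmul_matrix)
  qed
  from det_add_outer_axis[OF this, of "norm v" k] have
    "det (R ** P ** transpose R) \<le> det (R ** P ** transpose R + R ** outer_product v ** transpose R)"
    by (simp add: conj_outer Rv)
  also have "R ** P ** transpose R + R ** outer_product v ** transpose R = R ** (P + outer_product v) ** transpose R"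
    by (simp add: vec_eq_iff matrix_matrix_mult_def distrib_left distrib_right sum.distrib)
  finally show ?thesis by (simp add: det_conj)
qed

lemma det_scaleR_matrix:
  fixes P :: "real^'n^'n"
  shows "det (c *\<^sub>R P) = c ^ CARD('n) * det P"
proof -
  have "c *\<^sub>R P = (\<chi> i. c *s P $ i)"
    by (simp add: vec_eq_iff)
  then show ?thesis
    using det_rows_mul[of "\<lambda>_. c" "\<lambda>i. P $ i"] by simp
qed

section \<open>Random variables with all moments\<close>

text \<open>
  A class that contains the bounded coefficients of simple processes as well as Gaussian variables and
  that is closed under products: every product of such variables that occurs below is integrable.
\<close>

definition all_moments :: "'a measure \<Rightarrow> ('a \<Rightarrow> real) \<Rightarrow> bool" where
  "all_moments M X \<longleftrightarrow> X \<in> borel_measurable M \<and> (\<forall>p::nat. integrable M (\<lambda>\<omega>. \<bar>X \<omega>\<bar> ^ p))"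

lemma all_moments_measurable: "all_moments M X \<Longrightarrow> X \<in> borel_measurable M"
  by (simp add: all_moments_def)

lemma all_moments_power_integrable:
  assumes "all_moments M X" shows "integrable M (\<lambda>\<omega>. X \<omega> ^ p)"
proof (rule Bochner_Integration.integrable_bound)
  show "integrable M (\<lambda>\<omega>. \<bar>X \<omega>\<bar> ^ p)" "(\<lambda>\<omega>. X \<omega> ^ p) \<in> borel_measurable M"
    using assms by (auto simp: all_moments_def)
qed (simp add: power_abs)

lemma all_moments_integrable: "all_moments M X \<Longrightarrow> integrable M X"
  using all_moments_power_integrable[of M X 1] by simp

lemma all_moments_mult:
  assumes X: "all_moments M X" and Y: "all_moments M Y"
  shows "all_moments M (\<lambda>\<omega>. X \<omega> * Y \<omega>)"
  unfolding all_moments_def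
proof safe
  have [measurable]: "X \<in> borel_measurable M" "Y \<in> borel_measurable M"
    using X Y by (auto simp: all_moments_def)
  show "(\<lambda>\<omega>. X \<omega> * Y \<omega>) \<in> borel_measurable M" by simp
  fix p :: nat
  show "integrable M (\<lambda>\<omega>. \<bar>X \<omega> * Y \<omega>\<bar> ^ p)"
  proof (rule Bochner_Integration.integrable_bound)
    show "integrable M (\<lambda>\<omega>. \<bar>X \<omega>\<bar> ^ (2 * p) + \<bar>Y \<omega>\<bar> ^ (2 * p))"
      using X Y by (auto simp: all_moments_def)
    have "a ^ p * b ^ p \<le> a ^ (2 * p) + b ^ (2 * p)" if "a \<ge> 0" "b \<ge> 0" for a b :: real
    proof -
      have "2 * (a ^ p * b ^ p) \<le> a ^ (2 * p) + b ^ (2 * p)"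
        using sum_squares_bound[of "a ^ p" "b ^ p"] by (simp add: power_even_eq mult.assoc)
      moreover have "0 \<le> a ^ p * b ^ p" using that by simp
      ultimately show ?thesis by linarith
    qed
    then show "AE \<omega> in M. norm (\<bar>X \<omega> * Y \<omega>\<bar> ^ p) \<le> norm (\<bar>X \<omega>\<bar> ^ (2 * p) + \<bar>Y \<omega>\<bar> ^ (2 * p))"
      by (simp add: abs_mult power_mult_distrib)
  qed simp
qed

lemma all_moments_add:
  assumes X: "all_moments M X" and Y: "all_moments M Y"
  shows "all_moments M (\<lambda>\<omega>. X \<omega> + Y \<omega>)"
  unfolding all_moments_def
proof safe
  have [measurable]: "X \<in> borel_measurable M" "Y \<in> borel_measurable M"
    using X Y by (auto simp: all_moments_def)
  show "(\<lambda>\<omega>. X \<omega> + Y \<omega>) \<in> borel_measurable M" by simp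
  fix p :: nat
  show "integrable M (\<lambda>\<omega>. \<bar>X \<omega> + Y \<omega>\<bar> ^ p)"
  proof (rule Bochner_Integration.integrable_bound)
    show "integrable M (\<lambda>\<omega>. 2 ^ p * (\<bar>X \<omega>\<bar> ^ p + \<bar>Y \<omega>\<bar> ^ p))"
      using X Y by (auto simp: all_moments_def)
    have "\<bar>a + b\<bar> ^ p \<le> 2 ^ p * (\<bar>a\<bar> ^ p + \<bar>b\<bar> ^ p)" for a b :: real
    proof -
      have "\<bar>a + b\<bar> ^ p \<le> (2 * max \<bar>a\<bar> \<bar>b\<bar>) ^ p"
        by (intro power_mono) auto
      also have "\<dots> = 2 ^ p * max \<bar>a\<bar> \<bar>b\<bar> ^ p" by (simp add: power_mult_distrib)
      also have "\<dots> \<le> 2 ^ p * (\<bar>a\<bar> ^ p + \<bar>b\<bar> ^ p)"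
        by (intro mult_left_mono) (auto simp: max_def)
      finally show ?thesis .
    qed
    then show "AE \<omega> in M. norm (\<bar>X \<omega> + Y \<omega>\<bar> ^ p) \<le> norm (2 ^ p * (\<bar>X \<omega>\<bar> ^ p + \<bar>Y \<omega>\<bar> ^ p))"
      by simp
  qed simp
qed

lemma (in finite_measure) all_moments_bounded:
  assumes "X \<in> borel_measurable M" "\<And>\<omega>. \<omega> \<in> space M \<Longrightarrow> \<bar>X \<omega>\<bar> \<le> c"
  shows "all_moments M X"
  unfolding all_moments_def
proof safe
  fix p :: nat
  show "integrable M (\<lambda>\<omega>. \<bar>X \<omega>\<bar> ^ p)"
    by (rule integrable_const_bound[where B="c ^ p"]) (use assms in \<open>auto intro!: power_mono AE_I2\<close>)
qed (rule assms)

lemma (in finite_measure) all_moments_const: "all_moments M (\<lambda>_. c)"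
  by (rule all_moments_bounded[where c="\<bar>c\<bar>"]) auto

lemma all_moments_AE_cong:
  assumes "all_moments M X" "Y \<in> borel_measurable M" "AE \<omega> in M. X \<omega> = Y \<omega>"
  shows "all_moments M Y"
  unfolding all_moments_def
proof safe
  fix p :: nat
  have "integrable M (\<lambda>\<omega>. \<bar>X \<omega>\<bar> ^ p)"
    using assms(1) by (simp add: all_moments_def)
  then show "integrable M (\<lambda>\<omega>. \<bar>Y \<omega>\<bar> ^ p)"
    by (rule integrable_cong_AE_imp) (use assms in auto)
qed (rule assms)

section \<open>Moments of Gaussian vectors\<close>

lemma normal_density_all_moments:
  assumes X: "distributed M lborel X (normal_density \<mu> \<sigma>)" and s: "\<sigma> > 0" and "prob_space M"
  shows "all_moments M X"
proof -
  interpret prob_space M by fact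
  note Xm = distributed_measurable[OF X]
  have "all_moments M (\<lambda>\<omega>. X \<omega> - \<mu>)"
    unfolding all_moments_def
  proof safe
    fix p :: nat
    show "integrable M (\<lambda>\<omega>. \<bar>X \<omega> - \<mu>\<bar> ^ p)"
      using distributed_integrable[OF X, of "\<lambda>x. \<bar>x - \<mu>\<bar> ^ p"] integrable_normal_moment_abs[OF s, of \<mu> p]
      by simp
  qed (use Xm in simp)
  from all_moments_add[OF this all_moments_const[of \<mu>]] show ?thesis by simp
qed

lemma normal_rv_all_moments:
  assumes "normal_rv M X" "prob_space M"
  shows "all_moments M X"
proof -
  interpret prob_space M by fact
  show ?thesis
    using assms(1) unfolding normal_rv_def
  proof (elim conjE disjE exE)
    fix \<mu> assume "X \<in> borel_measurable M" "AE \<omega> in M. X \<omega> = \<mu>"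
    then show ?thesis
      by (intro all_moments_AE_cong[OF all_moments_const[of \<mu>]]) auto
  qed (auto intro: normal_density_all_moments assms)
qed

text \<open>
  A degenerate normal law with mean zero is concentrated at 0, so the formulas cover it too.
\<close>

lemma centred_normal_rv_moments:
  assumes X: "normal_rv M X" and "prob_space M" and 0: "(\<integral>\<omega>. X \<omega> \<partial>M) = 0"
  shows "(\<integral>\<omega>. X \<omega> ^ 3 \<partial>M) = 0" "(\<integral>\<omega>. X \<omega> ^ 4 \<partial>M) = 3 * (\<integral>\<omega>. X \<omega> ^ 2 \<partial>M)\<^sup>2"
proof -
  interpret prob_space M by fact
  have "(\<integral>\<omega>. X \<omega> ^ 3 \<partial>M) = 0 \<and> (\<integral>\<omega>. X \<omega> ^ 4 \<partial>M) = 3 * (\<integral>\<omega>. X \<omega> ^ 2 \<partial>M)\<^sup>2"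
    using X unfolding normal_rv_def
  proof (elim conjE disjE exE)
    fix \<mu> assume [measurable]: "X \<in> borel_measurable M" and X: "AE \<omega> in M. X \<omega> = \<mu>"
    have "(\<integral>\<omega>. X \<omega> ^ p \<partial>M) = \<mu> ^ p" for p
    proof -
      have "(\<integral>\<omega>. X \<omega> ^ p \<partial>M) = (\<integral>\<omega>. \<mu> ^ p \<partial>M)"
        by (rule integral_cong_AE) (use X in auto)
      then show ?thesis by (simp add: prob_space)
    qed
    from this[of 1] this[of 2] this[of 3] this[of 4] 0 show ?thesis by simp
  next
    fix \<mu> \<sigma> :: real
    assume s: "\<sigma> > 0" and X: "distributed M lborel X (normal_density \<mu> \<sigma>)"
    note int = distributed_integral[OF X, symmetric]
    have "\<mu> = 0"
      using int[of "\<lambda>x. x"] integral_normal_moment_nz_1[OF s, of \<mu>] 0 by simp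
    then show ?thesis
      using int[of "\<lambda>x. x ^ 2"] int[of "\<lambda>x. x ^ 3"] int[of "\<lambda>x. x ^ 4"]
        integral_normal_moment_even[OF s, of \<mu> 1] integral_normal_moment_even[OF s, of \<mu> 2]
        integral_normal_moment_odd[OF s, of \<mu> 1]
      by (simp add: fact_numeral field_simps power2_eq_square power3_eq_cube power4_eq_xxxx)
  qed
  then show "(\<integral>\<omega>. X \<omega> ^ 3 \<partial>M) = 0" "(\<integral>\<omega>. X \<omega> ^ 4 \<partial>M) = 3 * (\<integral>\<omega>. X \<omega> ^ 2 \<partial>M)\<^sup>2"
    by auto
qed

locale centred_gaussian = prob_space M for M :: "'a measure" +
  fixes S :: "real^'k^'k" and X :: "'a \<Rightarrow> real^'k"
  assumes gaussian: "mean_zero_normal M S X"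
begin

lemma normal_inner: "normal_rv M (\<lambda>\<omega>. u \<bullet> X \<omega>)"
  using gaussian by (simp add: mean_zero_normal_def multivariate_normal_def)

lemma moments_inner: "all_moments M (\<lambda>\<omega>. u \<bullet> X \<omega>)"
  by (rule normal_rv_all_moments[OF normal_inner prob_space_axioms])

lemma moments_nth: "all_moments M (\<lambda>\<omega>. X \<omega> $ i)"
  using moments_inner[of "axis i 1"] by (simp add: inner_axis inner_commute)

lemma mean_nth: "(\<integral>\<omega>. X \<omega> $ i \<partial>M) = 0"
  using gaussian by (simp add: mean_zero_normal_def)

lemma mean_inner: "(\<integral>\<omega>. u \<bullet> X \<omega> \<partial>M) = 0"
  by (simp add: inner_vec_def Bochner_Integration.integral_sum all_moments_integrable[OF moments_nth]
      mean_nth)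

lemma second_moment: "(\<integral>\<omega>. X \<omega> $ i * X \<omega> $ j \<partial>M) = S $ i $ j"
proof -
  have "S $ i $ j = cov_matrix M X $ i $ j"
    using gaussian by (simp add: mean_zero_normal_def)
  then show ?thesis by (simp add: cov_matrix_def mean_nth)
qed

lemma cov_symmetric: "S $ i $ j = S $ j $ i"
  by (simp add: second_moment[symmetric] mult.commute)

text \<open>
  Polarization of the third moments of the linear combinations of the three coordinates.
\<close>

lemma third_moment: "(\<integral>\<omega>. X \<omega> $ i * X \<omega> $ j * X \<omega> $ k \<partial>M) = 0"
proof -
  define U V W where "U = (\<lambda>\<omega>. X \<omega> $ i)" and "V = (\<lambda>\<omega>. X \<omega> $ j)" and "W = (\<lambda>\<omega>. X \<omega> $ k)"
  define c where "c a b e = a *\<^sub>R axis i 1 + b *\<^sub>R axis j 1 + e *\<^sub>R (axis k 1 :: real^'k)" for a b e :: real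
  have c: "c a b e \<bullet> X \<omega> = a * U \<omega> + b * V \<omega> + e * W \<omega>" for a b e \<omega>
    by (simp add: c_def U_def V_def W_def inner_add_left inner_axis')
  have int: "integrable M (\<lambda>\<omega>. (a * U \<omega> + b * V \<omega> + e * W \<omega>) ^ 3)"
    and zero: "(\<integral>\<omega>. (a * U \<omega> + b * V \<omega> + e * W \<omega>) ^ 3 \<partial>M) = 0" for a b e
    using all_moments_power_integrable[OF moments_inner[of "c a b e"], of 3]
      centred_normal_rv_moments(1)[OF normal_inner[of "c a b e"] prob_space_axioms mean_inner]
    by (auto simp: c)
  define f where "f a b e \<omega> = (a * U \<omega> + b * V \<omega> + e * W \<omega>) ^ 3" for a b e :: real and \<omega>
  have "24 * (U \<omega> * V \<omega> * W \<omega>) = f 1 1 1 \<omega> - f 1 1 (-1) \<omega> - f 1 (-1) 1 \<omega> - f (-1) 1 1 \<omega>" for \<omega>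
    unfolding f_def by algebra
  then have "(\<integral>\<omega>. 24 * (U \<omega> * V \<omega> * W \<omega>) \<partial>M)
      = (\<integral>\<omega>. f 1 1 1 \<omega> - f 1 1 (-1) \<omega> - f 1 (-1) 1 \<omega> - f (-1) 1 1 \<omega> \<partial>M)"
    by simp
  also have "\<dots> = 0"
    using int zero unfolding f_def[symmetric] by simp
  finally show ?thesis by (simp add: U_def V_def W_def)
qed

text \<open>
  The instance of Isserlis' formula with a repeated index, by polarization of
  \<open>E (u \<bullet> X)\<^sup>4 = 3 (E (u \<bullet> X)\<^sup>2)\<^sup>2\<close>. The variance \<open>q a b e\<close> of a combination \<open>f a b e\<close> of the
  coordinates is a quadratic form with coefficients from \<open>S\<close>.
\<close>

lemma fourth_moment:
  "(\<integral>\<omega>. (X \<omega> $ i)\<^sup>2 * (X \<omega> $ j * X \<omega> $ k) \<partial>M) = S $ i $ i * S $ j $ k + 2 * (S $ i $ j * S $ i $ k)"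
proof -
  define U V W where "U = (\<lambda>\<omega>. X \<omega> $ i)" and "V = (\<lambda>\<omega>. X \<omega> $ j)" and "W = (\<lambda>\<omega>. X \<omega> $ k)"
  define c where "c a b e = a *\<^sub>R axis i 1 + b *\<^sub>R axis j 1 + e *\<^sub>R (axis k 1 :: real^'k)" for a b e :: real
  define f where "f a b e \<omega> = a * U \<omega> + b * V \<omega> + e * W \<omega>" for a b e :: real and \<omega>
  define q where "q a b e = a\<^sup>2 * S$i$i + b\<^sup>2 * S$j$j + e\<^sup>2 * S$k$k
     + 2 * a * b * S$i$j + 2 * a * e * S$i$k + 2 * b * e * S$j$k" for a b e
  have c: "c a b e \<bullet> X \<omega> = f a b e \<omega>" for a b e \<omega>
    by (simp add: c_def f_def U_def V_def W_def inner_add_left inner_axis')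
  have prods: "integrable M (\<lambda>\<omega>. X \<omega> $ a * X \<omega> $ b)" for a b
    by (intro all_moments_integrable all_moments_mult moments_nth)
  have "(\<integral>\<omega>. f a b e \<omega> ^ 2 \<partial>M) = q a b e" for a b e
  proof -
    have "f a b e \<omega> ^ 2 = a\<^sup>2 * (U \<omega> * U \<omega>) + b\<^sup>2 * (V \<omega> * V \<omega>) + e\<^sup>2 * (W \<omega> * W \<omega>)
      + 2 * a * b * (U \<omega> * V \<omega>) + 2 * a * e * (U \<omega> * W \<omega>) + 2 * b * e * (V \<omega> * W \<omega>)" for \<omega>
      unfolding f_def by algebra
    then show ?thesis
      by (simp add: U_def V_def W_def q_def prods second_moment)
  qed
  then have int: "integrable M (\<lambda>\<omega>. f a b e \<omega> ^ 4)"
    and val: "(\<integral>\<omega>. f a b e \<omega> ^ 4 \<partial>M) = 3 * (q a b e)\<^sup>2" for a b e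
    using all_moments_power_integrable[OF moments_inner[of "c a b e"], of 4]
      centred_normal_rv_moments(2)[OF normal_inner[of "c a b e"] prob_space_axioms mean_inner]
    by (auto simp: c)
  have "48 * ((U \<omega>)\<^sup>2 * (V \<omega> * W \<omega>)) = f 1 1 1 \<omega> ^ 4 + f 1 (-1) (-1) \<omega> ^ 4 - f 1 1 (-1) \<omega> ^ 4
      - f 1 (-1) 1 \<omega> ^ 4 - 2 * f 0 1 1 \<omega> ^ 4 + 2 * f 0 1 (-1) \<omega> ^ 4" for \<omega>
    unfolding f_def by algebra
  then have "(\<integral>\<omega>. 48 * ((U \<omega>)\<^sup>2 * (V \<omega> * W \<omega>)) \<partial>M)
      = (\<integral>\<omega>. f 1 1 1 \<omega> ^ 4 + f 1 (-1) (-1) \<omega> ^ 4 - f 1 1 (-1) \<omega> ^ 4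
      - f 1 (-1) 1 \<omega> ^ 4 - 2 * f 0 1 1 \<omega> ^ 4 + 2 * f 0 1 (-1) \<omega> ^ 4 \<partial>M)"
    by simp
  also have "\<dots> = 3 * (q 1 1 1)\<^sup>2 + 3 * (q 1 (-1) (-1))\<^sup>2 - 3 * (q 1 1 (-1))\<^sup>2 - 3 * (q 1 (-1) 1)\<^sup>2
      - 6 * (q 0 1 1)\<^sup>2 + 6 * (q 0 1 (-1))\<^sup>2"
    by (simp add: int val)
  also have "\<dots> = 48 * (S $ i $ i * S $ j $ k + 2 * (S $ i $ j * S $ i $ k))"
    by (simp add: q_def power2_eq_square algebra_simps)
  finally show ?thesis by (simp add: U_def V_def W_def)
qed

end

lemma (in centred_gaussian) cov_matrix_product:
  "cov_matrix M (\<lambda>\<omega>. \<chi> j. X \<omega> $ i * X \<omega> $ f j) =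
     (\<chi> j k. S $ i $ i * S $ f j $ f k + S $ i $ f j * S $ i $ f k)"
proof -
  have int: "integrable M (\<lambda>\<omega>. X \<omega> $ a * X \<omega> $ b)" 
    "integrable M (\<lambda>\<omega>. (X \<omega> $ i)\<^sup>2 * (X \<omega> $ a * X \<omega> $ b))" for a b
    unfolding power2_eq_square by (intro all_moments_integrable all_moments_mult moments_nth)+
  have "(\<integral>\<omega>. (X \<omega> $ i * X \<omega> $ a - S $ i $ a) * (X \<omega> $ i * X \<omega> $ b - S $ i $ b) \<partial>M)
    = S $ i $ i * S $ a $ b + S $ i $ a * S $ i $ b" for a b
  proof -
    have "(X \<omega> $ i * X \<omega> $ a - S $ i $ a) * (X \<omega> $ i * X \<omega> $ b - S $ i $ b)
      = (X \<omega> $ i)\<^sup>2 * (X \<omega> $ a * X \<omega> $ b) - S $ i $ b * (X \<omega> $ i * X \<omega> $ a)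
        - S $ i $ a * (X \<omega> $ i * X \<omega> $ b) + S $ i $ a * S $ i $ b" for \<omega>
      by algebra
    then show ?thesis
      by (simp add: int second_moment fourth_moment prob_space)
  qed
  then show ?thesis
    by (simp add: cov_matrix_def second_moment)
qed

section \<open>Brownian increments against the past\<close>

lemma borel_measurable_nth [measurable (raw)]:
  fixes f :: "'a \<Rightarrow> real^'k"
  shows "f \<in> borel_measurable M \<Longrightarrow> (\<lambda>x. f x $ i) \<in> borel_measurable M"
  by (erule measurable_compose) (intro borel_measurable_continuous_onI continuous_intros)

lemma integral_sum_of_four:
  fixes f g h k :: "'a \<Rightarrow> real"
  assumes "integrable M f" "integrable M g" "integrable M h" "integrable M k"
  shows "(\<integral>x. f x + g x + h x + k x \<partial>M) = (\<integral>x. f x \<partial>M) + (\<integral>x. g x \<partial>M) + (\<integral>x. h x \<partial>M) + (\<integral>x. k x \<partial>M)"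
  using assms by simp

lemma (in prob_space) indep_set_mono:
  "indep_set A B \<Longrightarrow> A' \<subseteq> A \<Longrightarrow> B' \<subseteq> B \<Longrightarrow> indep_set A' B'"
  unfolding indep_sets2_eq by blast

context brownian_motion
begin

abbreviation past :: "real \<Rightarrow> 'a measure" where
  "past \<equiv> natural_filtration M B"

definition incr :: "'k \<Rightarrow> real \<Rightarrow> real \<Rightarrow> 'a \<Rightarrow> real" where
  "incr i s t \<omega> = B t \<omega> $ i - B s \<omega> $ i"

text \<open>
  The random variables that may serve as coefficients for increments after time \<open>t\<close>.
\<close>

definition known_at :: "real \<Rightarrow> ('a \<Rightarrow> real) \<Rightarrow> bool" where
  "known_at t G \<longleftrightarrow> G \<in> borel_measurable (past t) \<and> all_moments M G"

lemma space_past [simp]: "space (past t) = space M"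
  unfolding natural_filtration_def by (rule space_measure_of) auto

lemma sets_past:
  "sets (past t) = sigma_sets (space M) {B s -` A \<inter> space M | s A. 0 \<le> s \<and> s \<le> t \<and> A \<in> sets borel}"
  unfolding natural_filtration_def by (rule sets_measure_of) auto

lemma sets_past_mono: "s \<le> t \<Longrightarrow> sets (past s) \<subseteq> sets (past t)"
  unfolding sets_past by (rule sigma_sets_mono') force

lemma sets_past_subset: "sets (past t) \<subseteq> sets M"
  unfolding sets_past
  by (rule sets.sigma_sets_subset) (auto intro: measurable_sets[OF measurable_B])

lemma measurable_past_mono:
  "G \<in> borel_measurable (past s) \<Longrightarrow> s \<le> t \<Longrightarrow> G \<in> borel_measurable (past t)"
  using sets_past_mono[of s t] by (auto simp: measurable_def)

lemma measurable_past: "G \<in> borel_measurable (past s) \<Longrightarrow> G \<in> borel_measurable M"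
  using sets_past_subset[of s] by (auto simp: measurable_def)

lemma B_measurable_past: "0 \<le> s \<Longrightarrow> s \<le> t \<Longrightarrow> B s \<in> borel_measurable (past t)"
  by (rule measurableI) (auto simp: sets_past)

lemma gaussian_increment:
  assumes "0 \<le> s" "s \<le> t"
  shows "centred_gaussian M ((t - s) *\<^sub>R S) (\<lambda>\<omega>. B t \<omega> - B s \<omega>)"
  by unfold_locales (rule normal_increments[OF assms])

text \<open>
  The process is only almost surely zero at time 0, so the law of \<open>B t\<close> is transferred from that of the
  increment \<open>B t - B 0\<close> along an almost sure equality.
\<close>

lemma gaussian_B:
  assumes "0 \<le> t"
  shows "centred_gaussian M (t *\<^sub>R S) (B t)"
proof
  have eq: "AE \<omega> in M. B t \<omega> - B 0 \<omega> = B t \<omega>"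
    using start by simp
  have [measurable]: "B t \<in> borel_measurable M" "B 0 \<in> borel_measurable M"
    using measurable_B assms by auto
  have N: "mean_zero_normal M (t *\<^sub>R S) (\<lambda>\<omega>. B t \<omega> - B 0 \<omega>)"
    using normal_increments[OF order_refl assms] by simp
  have "(\<integral>\<omega>. (B t \<omega> - B 0 \<omega>) $ i \<partial>M) = (\<integral>\<omega>. B t \<omega> $ i \<partial>M)" for i
    by (rule integral_cong_AE) (use eq in auto)
  moreover have "cov_matrix M (\<lambda>\<omega>. B t \<omega> - B 0 \<omega>) = cov_matrix M (B t)"
  proof -
    have "(\<integral>\<omega>. (B t \<omega> - B 0 \<omega>) $ i * (B t \<omega> - B 0 \<omega>) $ j \<partial>M) = (\<integral>\<omega>. B t \<omega> $ i * B t \<omega> $ j \<partial>M)" for i j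
      by (rule integral_cong_AE) (use eq in auto)
    then show ?thesis
      using N calculation by (simp add: cov_matrix_def mean_zero_normal_def)
  qed
  moreover have "normal_rv M (\<lambda>\<omega>. u \<bullet> B t \<omega>)" for u
  proof -
    have ae: "AE \<omega> in M. u \<bullet> (B t \<omega> - B 0 \<omega>) = u \<bullet> B t \<omega>"
      using eq by auto
    have d: "distr M lborel (\<lambda>\<omega>. u \<bullet> (B t \<omega> - B 0 \<omega>)) = distr M lborel (\<lambda>\<omega>. u \<bullet> B t \<omega>)"
      by (rule distr_cong_AE) (use ae in auto)
    have "normal_rv M (\<lambda>\<omega>. u \<bullet> (B t \<omega> - B 0 \<omega>))"
      using N by (simp add: mean_zero_normal_def multivariate_normal_def)
    then show ?thesis
      unfolding normal_rv_def
    proof (elim conjE disjE exE)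
      fix \<mu> \<sigma> :: real
      assume "\<sigma> > 0" "distributed M lborel (\<lambda>\<omega>. u \<bullet> (B t \<omega> - B 0 \<omega>)) (normal_density \<mu> \<sigma>)"
      then have "distributed M lborel (\<lambda>\<omega>. u \<bullet> B t \<omega>) (normal_density \<mu> \<sigma>)"
        using d by (simp add: distributed_def)
      with \<open>\<sigma> > 0\<close> show "(\<lambda>\<omega>. u \<bullet> B t \<omega>) \<in> borel_measurable M \<and>
        ((\<exists>\<mu> \<sigma>. 0 < \<sigma> \<and> distributed M lborel (\<lambda>\<omega>. u \<bullet> B t \<omega>) (\<lambda>x. ennreal (normal_density \<mu> \<sigma> x))) \<or>
         (\<exists>\<mu>. AE \<omega> in M. u \<bullet> B t \<omega> = \<mu>))"
        by auto
    next
      fix \<mu> assume "AE \<omega> in M. u \<bullet> (B t \<omega> - B 0 \<omega>) = \<mu>"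
      with ae have "AE \<omega> in M. u \<bullet> B t \<omega> = \<mu>" by (auto elim: eventually_elim2)
      then show "(\<lambda>\<omega>. u \<bullet> B t \<omega>) \<in> borel_measurable M \<and>
        ((\<exists>\<mu> \<sigma>. 0 < \<sigma> \<and> distributed M lborel (\<lambda>\<omega>. u \<bullet> B t \<omega>) (\<lambda>x. ennreal (normal_density \<mu> \<sigma> x))) \<or>
         (\<exists>\<mu>. AE \<omega> in M. u \<bullet> B t \<omega> = \<mu>))"
        by auto
    qed
  qed
  ultimately show "mean_zero_normal M (t *\<^sub>R S) (B t)"
    using N by (simp add: mean_zero_normal_def multivariate_normal_def)
qed

lemma S_symmetric: "S $ i $ j = S $ j $ i"
  using centred_gaussian.cov_symmetric[OF gaussian_B[of 1], of i j] by simp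

lemma known_at_B: "0 \<le> s \<Longrightarrow> s \<le> t \<Longrightarrow> known_at t (\<lambda>\<omega>. B s \<omega> $ i)"
  unfolding known_at_def
  using B_measurable_past[of s t] centred_gaussian.moments_nth[OF gaussian_B[of s], of i]
  by (auto intro: borel_measurable_nth)

lemma known_at_mult: "known_at t G \<Longrightarrow> known_at t H \<Longrightarrow> known_at t (\<lambda>\<omega>. G \<omega> * H \<omega>)"
  unfolding known_at_def by (auto intro: all_moments_mult)

lemma known_at_add: "known_at t G \<Longrightarrow> known_at t H \<Longrightarrow> known_at t (\<lambda>\<omega>. G \<omega> + H \<omega>)"
  unfolding known_at_def by (auto intro: all_moments_add)

lemma known_at_const: "known_at t (\<lambda>_. c)"
  unfolding known_at_def by (auto intro: all_moments_const)

lemma known_at_mono: "known_at s G \<Longrightarrow> s \<le> t \<Longrightarrow> known_at t G"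
  unfolding known_at_def by (auto intro: measurable_past_mono)

lemma known_at_incr: "0 \<le> s \<Longrightarrow> s \<le> t \<Longrightarrow> t \<le> u \<Longrightarrow> known_at u (incr i s t)"
  using known_at_add[OF known_at_B[of t u i] known_at_mult[OF known_at_const[of u "-1"] known_at_B[of s u i]]]
  unfolding incr_def[abs_def] by simp

lemma known_at_integrable: "known_at t G \<Longrightarrow> integrable M G"
  unfolding known_at_def by (auto intro: all_moments_integrable)

lemma incr_split: "incr i s t \<omega> = incr i s u \<omega> + incr i u t \<omega>"
  by (simp add: incr_def)

text \<open>
  The independence of the past and the vector-valued increment is used through a real-valued function
  \<open>g\<close> of the increment; products of its coordinates are what occurs later.
\<close>

lemma past_times_increment:
  fixes g :: "real^'k \<Rightarrow> real"
  assumes st: "0 \<le> s" "s \<le> t" and G: "G \<in> borel_measurable (past s)" "integrable M G"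
    and g: "g \<in> borel_measurable borel" "integrable M (\<lambda>\<omega>. g (B t \<omega> - B s \<omega>))"
  shows "(\<integral>\<omega>. G \<omega> * g (B t \<omega> - B s \<omega>) \<partial>M) = (\<integral>\<omega>. G \<omega> \<partial>M) * (\<integral>\<omega>. g (B t \<omega> - B s \<omega>) \<partial>M)"
proof (rule indep_var_lebesgue_integral)
  have [measurable]: "B t \<in> borel_measurable M" "B s \<in> borel_measurable M"
    using measurable_B st by auto
  let ?D = "\<lambda>\<omega>. B t \<omega> - B s \<omega>"
  let ?X = "{G -` A \<inter> space M | A. A \<in> sets borel}"
  let ?Y = "{(\<lambda>\<omega>. g (?D \<omega>)) -` A \<inter> space M | A. A \<in> sets borel}"
  have sub: "?X \<subseteq> sets (past s)" "?Y \<subseteq> {?D -` A \<inter> space M | A. A \<in> sets borel}"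
  proof -
    show "?X \<subseteq> sets (past s)"
      using measurable_sets[OF G(1)] by auto
    show "?Y \<subseteq> {?D -` A \<inter> space M | A. A \<in> sets borel}"
    proof clarify
      fix A :: "real set" assume "A \<in> sets borel"
      then have "g -` A \<in> sets borel" using measurable_sets[OF g(1)] by simp
      then show "\<exists>A'. (\<lambda>\<omega>. g (?D \<omega>)) -` A \<inter> space M = ?D -` A' \<inter> space M \<and> A' \<in> sets borel"
        by (intro exI[of _ "g -` A"]) auto
    qed
  qed
  have "indep_set ?X ?Y"
    by (rule indep_set_mono[OF independent_increments[OF st] sub])
  moreover have "Int_stable {f -` A \<inter> space M | A. A \<in> sets borel}" for f :: "'a \<Rightarrow> real"
  proof (rule Int_stableI, clarify)
    fix A A' :: "real set" assume "A \<in> sets borel" "A' \<in> sets borel"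
    then show "\<exists>A''. (f -` A \<inter> space M) \<inter> (f -` A' \<inter> space M) = f -` A'' \<inter> space M \<and> A'' \<in> sets borel"
      by (intro exI[of _ "A \<inter> A'"]) auto
  qed
  ultimately have "indep_set (sigma_sets (space M) ?X) (sigma_sets (space M) ?Y)"
    by (intro indep_set_sigma_sets)
  then show "indep_var borel G borel (\<lambda>\<omega>. g (?D \<omega>))"
    unfolding indep_var_eq using measurable_past[OF G(1)] g by auto
qed (rule G g)+

lemma past_times_incr:
  assumes "0 \<le> s" "s \<le> t" "known_at s G"
  shows "(\<integral>\<omega>. G \<omega> * incr i s t \<omega> \<partial>M) = 0"
    and "(\<integral>\<omega>. G \<omega> * (incr i s t \<omega> * incr j s t \<omega>) \<partial>M) = (\<integral>\<omega>. G \<omega> \<partial>M) * ((t - s) * S $ i $ j)"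
    and "(\<integral>\<omega>. G \<omega> * (incr i s t \<omega> * incr j s t \<omega> * incr k s t \<omega>) \<partial>M) = 0"
proof -
  interpret D: centred_gaussian M "(t - s) *\<^sub>R S" "\<lambda>\<omega>. B t \<omega> - B s \<omega>"
    by (rule gaussian_increment) fact+
  note indep = past_times_increment[OF assms(1,2)]
  have G: "G \<in> borel_measurable (past s)" "integrable M G"
    using assms(3) known_at_integrable[OF assms(3)] by (auto simp: known_at_def)
  have int: "integrable M (\<lambda>\<omega>. (B t \<omega> - B s \<omega>) $ i)"
     "integrable M (\<lambda>\<omega>. (B t \<omega> - B s \<omega>) $ i * (B t \<omega> - B s \<omega>) $ j)"
     "integrable M (\<lambda>\<omega>. (B t \<omega> - B s \<omega>) $ i * (B t \<omega> - B s \<omega>) $ j * (B t \<omega> - B s \<omega>) $ k)"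
    by (intro all_moments_integrable all_moments_mult D.moments_nth)+
  show "(\<integral>\<omega>. G \<omega> * incr i s t \<omega> \<partial>M) = 0"
    using indep[OF G _ int(1)] D.mean_nth[of i] by (simp add: incr_def)
  show "(\<integral>\<omega>. G \<omega> * (incr i s t \<omega> * incr j s t \<omega>) \<partial>M) = (\<integral>\<omega>. G \<omega> \<partial>M) * ((t - s) * S $ i $ j)"
    using indep[OF G, of "\<lambda>x. x $ i * x $ j"] int(2) D.second_moment[of i j] by (simp add: incr_def)
  show "(\<integral>\<omega>. G \<omega> * (incr i s t \<omega> * incr j s t \<omega> * incr k s t \<omega>) \<partial>M) = 0"
    using indep[OF G, of "\<lambda>x. x $ i * x $ j * x $ k"] int(3) D.third_moment[of i j k]
    by (simp add: incr_def)
qed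

text \<open>
  The martingale property of the coordinates, tested against the past.
\<close>

lemma past_times_B:
  assumes "0 \<le> s" "s \<le> t" "known_at s G"
  shows "(\<integral>\<omega>. G \<omega> * B t \<omega> $ i \<partial>M) = (\<integral>\<omega>. G \<omega> * B s \<omega> $ i \<partial>M)"
proof -
  have "(\<integral>\<omega>. G \<omega> * B t \<omega> $ i \<partial>M) = (\<integral>\<omega>. G \<omega> * B s \<omega> $ i + G \<omega> * incr i s t \<omega> \<partial>M)"
    by (simp add: incr_def algebra_simps)
  also have "\<dots> = (\<integral>\<omega>. G \<omega> * B s \<omega> $ i \<partial>M) + (\<integral>\<omega>. G \<omega> * incr i s t \<omega> \<partial>M)"
    using assms
    by (intro Bochner_Integration.integral_add known_at_integrable[of t] known_at_mult
        known_at_B known_at_incr) (auto intro: known_at_mono)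
  finally show ?thesis using past_times_incr(1)[OF assms] by simp
qed

section \<open>Elementary stochastic integrals\<close>

text \<open>
  Both intervals are cut at the ends of their overlap \<open>(c, e]\<close>. Every product of increments over
  different pieces contains a latest one that is independent of all other factors and has mean zero;
  only the square over the overlap remains. After \<open>e\<close> at most one of the two intervals continues.
\<close>

lemma elementary_isometry_ordered:
  assumes "0 \<le> a" "a \<le> c" "a \<le> b" "c \<le> d" and \<xi>: "known_at a \<xi>" and \<eta>: "known_at c \<eta>"
  shows "(\<integral>\<omega>. (\<xi> \<omega> * incr i a b \<omega>) * (\<eta> \<omega> * incr j c d \<omega>) \<partial>M)
    = (\<integral>\<omega>. \<xi> \<omega> * \<eta> \<omega> \<partial>M) * S $ i $ j * max 0 (min b d - c)"
proof (cases "b \<le> c")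
  case True
  have "known_at c (\<lambda>\<omega>. \<xi> \<omega> * incr i a b \<omega> * \<eta> \<omega>)"
    using assms True by (intro known_at_mult known_at_incr) (auto intro: known_at_mono)
  from past_times_incr(1)[OF _ _ this, of d j] show ?thesis
    using assms True by (simp add: mult_ac)
next
  case False
  define e where "e = min b d"
  have e: "c \<le> e" "e \<le> b" "e \<le> d" "e = b \<or> e = d"
    using assms False by (auto simp: e_def)
  have \<xi>c: "known_at c \<xi>" using \<xi> assms by (auto intro: known_at_mono)
  define G where "G \<omega> = \<xi> \<omega> * \<eta> \<omega>" for \<omega>
  have G: "known_at c G" unfolding G_def using \<xi>c \<eta> by (rule known_at_mult)
  then have Ge: "known_at e G" using e by (auto intro: known_at_mono)
  have K: "known_at c (\<lambda>\<omega>. G \<omega> * incr i a c \<omega>)" "known_at e (\<lambda>\<omega>. G \<omega> * incr i c e \<omega>)"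
    "known_at e (\<lambda>\<omega>. G \<omega> * incr j c e \<omega>)"
    using assms G Ge e by (auto intro!: known_at_mult known_at_incr)
  have int: "integrable M (\<lambda>\<omega>. G \<omega> * incr i p q \<omega> * incr j r s \<omega>)"
    if "0 \<le> p" "p \<le> q" "0 \<le> r" "r \<le> s" for p q r s
  proof -
    define m where "m = max c (max q s)"
    have "known_at m G" using G by (rule known_at_mono) (simp add: m_def)
    then show ?thesis
      using that by (intro known_at_integrable[of m] known_at_mult known_at_incr) (auto simp: m_def)
  qed
  note z1 = past_times_incr(1)[OF _ _ K(1), of d j]
  note z2 = past_times_incr(1)[OF _ _ K(2), of d j]
  note z3 = past_times_incr(1)[OF _ _ K(3), of b i]
  have "(\<xi> \<omega> * incr i a b \<omega>) * (\<eta> \<omega> * incr j c d \<omega>)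
    = G \<omega> * incr i a c \<omega> * incr j c d \<omega> + G \<omega> * incr i c e \<omega> * incr j c e \<omega>
      + G \<omega> * incr i c e \<omega> * incr j e d \<omega> + G \<omega> * incr j c e \<omega> * incr i e b \<omega>" for \<omega>
  proof -
    have "incr i e b \<omega> = 0 \<or> incr j e d \<omega> = 0" using e by (auto simp: incr_def)
    then show ?thesis
      using incr_split[of i a b \<omega> c] incr_split[of i c b \<omega> e] incr_split[of j c d \<omega> e]
      by (auto simp: G_def algebra_simps)
  qed
  then have "(\<integral>\<omega>. (\<xi> \<omega> * incr i a b \<omega>) * (\<eta> \<omega> * incr j c d \<omega>) \<partial>M)
    = (\<integral>\<omega>. G \<omega> * (incr i c e \<omega> * incr j c e \<omega>) \<partial>M)"
    using z1 z2 z3 assms e int[of a c c d] int[of c e c e] int[of c e e d] int[of e b c e]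
    by (simp add: mult_ac)
  also have "\<dots> = (\<integral>\<omega>. G \<omega> \<partial>M) * ((e - c) * S $ i $ j)"
    using assms e G by (intro past_times_incr(2)) auto
  also have "e - c = max 0 (min b d - c)"
    using e by (simp add: e_def)
  finally show ?thesis by (simp add: G_def)
qed

lemma elementary_isometry:
  assumes "0 \<le> a" "a \<le> b" "0 \<le> c" "c \<le> d" and \<xi>: "known_at a \<xi>" and \<eta>: "known_at c \<eta>"
  shows "(\<integral>\<omega>. (\<xi> \<omega> * incr i a b \<omega>) * (\<eta> \<omega> * incr j c d \<omega>) \<partial>M)
    = (\<integral>\<omega>. \<xi> \<omega> * \<eta> \<omega> \<partial>M) * S $ i $ j * max 0 (min b d - max a c)"
proof (cases "a \<le> c")
  case True
  then show ?thesis using elementary_isometry_ordered[of a c b d \<xi> \<eta> i j] assms by (simp add: max_def)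
next
  case False
  then show ?thesis using elementary_isometry_ordered[of c a d b \<eta> \<xi> j i] assms S_symmetric[of j i]
    by (simp add: max_def mult_ac min.commute)
qed

text \<open>
  First \<open>B T\<close> is split at \<open>b\<close>, where the increment after \<open>b\<close> contributes nothing: its first moment
  vanishes, and its second moment is multiplied by the expectation of \<open>\<xi> \<omega> * incr i a b \<omega>\<close>, which is
  zero. Then \<open>B b\<close> is split at \<open>a\<close>; the terms with one or three increments over \<open>(a, b]\<close> vanish.
\<close>

lemma elementary_integral_times_product:
  assumes "0 \<le> a" "a \<le> b" "b \<le> T" and \<xi>: "known_at a \<xi>"
  shows "(\<integral>\<omega>. (\<xi> \<omega> * incr i a b \<omega>) * (B T \<omega> $ j * B T \<omega> $ k) \<partial>M)
    = (b - a) * (S $ i $ k * (\<integral>\<omega>. \<xi> \<omega> * B a \<omega> $ j \<partial>M) + S $ i $ j * (\<integral>\<omega>. \<xi> \<omega> * B a \<omega> $ k \<partial>M))"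
proof -
  define D where "D \<omega> = \<xi> \<omega> * incr i a b \<omega>" for \<omega>
  have kD: "known_at b D"
    unfolding D_def using assms known_at_mono[OF \<xi>, of b] by (intro known_at_mult known_at_incr) auto
  have kB: "known_at b (\<lambda>\<omega>. B b \<omega> $ l)" "known_at a (\<lambda>\<omega>. B a \<omega> $ l)" "known_at b (\<lambda>\<omega>. B a \<omega> $ l)" for l
    using assms by (auto intro!: known_at_B)
  have kI: "known_at b (incr l a b)" "known_at T (incr l b T)" for l
    using assms by (auto intro!: known_at_incr)
  have up: "known_at T G" if "known_at b G" for G using that assms by (auto intro: known_at_mono)
  have "(\<integral>\<omega>. D \<omega> * (B T \<omega> $ j * B T \<omega> $ k) \<partial>M) =
    (\<integral>\<omega>. D \<omega> * B b \<omega> $ j * B b \<omega> $ k + D \<omega> * B b \<omega> $ j * incr k b T \<omega>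
      + D \<omega> * B b \<omega> $ k * incr j b T \<omega> + D \<omega> * (incr j b T \<omega> * incr k b T \<omega>) \<partial>M)"
    by (rule Bochner_Integration.integral_cong) (auto simp: incr_def algebra_simps)
  also have "\<dots> = (\<integral>\<omega>. D \<omega> * B b \<omega> $ j * B b \<omega> $ k \<partial>M)
      + (\<integral>\<omega>. D \<omega> * B b \<omega> $ j * incr k b T \<omega> \<partial>M) + (\<integral>\<omega>. D \<omega> * B b \<omega> $ k * incr j b T \<omega> \<partial>M)
      + (\<integral>\<omega>. D \<omega> * (incr j b T \<omega> * incr k b T \<omega>) \<partial>M)"
    by (intro integral_sum_of_four known_at_integrable[of T]
        known_at_mult up[OF kD] up[OF kB(1)] kI)
  also have "\<dots> = (\<integral>\<omega>. D \<omega> * B b \<omega> $ j * B b \<omega> $ k \<partial>M)"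
    using past_times_incr(1)[OF _ assms(3) known_at_mult[OF kD kB(1)]]
      past_times_incr(2)[OF _ assms(3) kD] past_times_incr(1)[OF assms(1,2) \<xi>] assms
    by (simp add: D_def)
  also have "\<dots> = (\<integral>\<omega>. \<xi> \<omega> * B a \<omega> $ j * B a \<omega> $ k * incr i a b \<omega>
      + \<xi> \<omega> * B a \<omega> $ j * (incr i a b \<omega> * incr k a b \<omega>)
      + \<xi> \<omega> * B a \<omega> $ k * (incr i a b \<omega> * incr j a b \<omega>)
      + \<xi> \<omega> * (incr i a b \<omega> * incr j a b \<omega> * incr k a b \<omega>) \<partial>M)"
    by (rule Bochner_Integration.integral_cong) (auto simp: incr_def D_def algebra_simps)
  also have "\<dots> = (\<integral>\<omega>. \<xi> \<omega> * B a \<omega> $ j * B a \<omega> $ k * incr i a b \<omega> \<partial>M)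
      + (\<integral>\<omega>. \<xi> \<omega> * B a \<omega> $ j * (incr i a b \<omega> * incr k a b \<omega>) \<partial>M)
      + (\<integral>\<omega>. \<xi> \<omega> * B a \<omega> $ k * (incr i a b \<omega> * incr j a b \<omega>) \<partial>M)
      + (\<integral>\<omega>. \<xi> \<omega> * (incr i a b \<omega> * incr j a b \<omega> * incr k a b \<omega>) \<partial>M)"
    by (intro integral_sum_of_four known_at_integrable[of b]
        known_at_mult known_at_mono[OF \<xi> assms(2)] kB kI)
  also have "\<dots> = 0 + (\<integral>\<omega>. \<xi> \<omega> * B a \<omega> $ j \<partial>M) * ((b - a) * S $ i $ k)
      + (\<integral>\<omega>. \<xi> \<omega> * B a \<omega> $ k \<partial>M) * ((b - a) * S $ i $ j) + 0"
    using past_times_incr(1)[OF assms(1,2) known_at_mult[OF known_at_mult[OF \<xi> kB(2)] kB(2)]]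
      past_times_incr(2)[OF assms(1,2) known_at_mult[OF \<xi> kB(2)]]
      past_times_incr(3)[OF assms(1,2) \<xi>]
    by (simp only:)
  finally show ?thesis by (simp add: D_def algebra_simps)
qed

end

section \<open>Mean-square limits\<close>

definition square_integrable :: "'a measure \<Rightarrow> ('a \<Rightarrow> real) \<Rightarrow> bool" where
  "square_integrable M X \<longleftrightarrow> X \<in> borel_measurable M \<and> integrable M (\<lambda>x. (X x)\<^sup>2)"

lemma square_integrable_of_all_moments: "all_moments M X \<Longrightarrow> square_integrable M X"
  unfolding square_integrable_def
  using all_moments_power_integrable all_moments_measurable by blast

lemma square_integrable_mult:
  assumes "square_integrable M X" "square_integrable M Y"
  shows "integrable M (\<lambda>x. X x * Y x)"
proof (rule Bochner_Integration.integrable_bound)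
  show "integrable M (\<lambda>x. (X x)\<^sup>2 + (Y x)\<^sup>2)" "(\<lambda>x. X x * Y x) \<in> borel_measurable M"
    using assms by (auto simp: square_integrable_def)
  have "\<bar>a * b\<bar> \<le> a\<^sup>2 + b\<^sup>2" for a b :: real
  proof -
    have "2 * (\<bar>a\<bar> * \<bar>b\<bar>) \<le> a\<^sup>2 + b\<^sup>2"
      using sum_squares_bound[of "\<bar>a\<bar>" "\<bar>b\<bar>"] by (simp add: mult.assoc)
    moreover have "0 \<le> \<bar>a\<bar> * \<bar>b\<bar>" by simp
    ultimately show ?thesis unfolding abs_mult by linarith
  qed
  then show "AE x in M. norm (X x * Y x) \<le> norm ((X x)\<^sup>2 + (Y x)\<^sup>2)"
    by simp
qed

lemma square_integrable_diff:
  assumes "square_integrable M X" "square_integrable M Y"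
  shows "square_integrable M (\<lambda>x. X x - Y x)"
proof -
  have "integrable M (\<lambda>x. (X x)\<^sup>2 + (Y x)\<^sup>2 - 2 * (X x * Y x))"
    using assms square_integrable_mult[OF assms] by (auto simp: square_integrable_def)
  moreover have "(X x)\<^sup>2 + (Y x)\<^sup>2 - 2 * (X x * Y x) = (X x - Y x)\<^sup>2" for x
    by (simp add: power2_diff)
  ultimately show ?thesis
    using assms by (auto simp: square_integrable_def)
qed

lemma Cauchy_Schwarz_integral:
  assumes U: "square_integrable M U" and V: "square_integrable M V"
  shows "\<bar>\<integral>x. U x * V x \<partial>M\<bar> \<le> sqrt (\<integral>x. (U x)\<^sup>2 \<partial>M) * sqrt (\<integral>x. (V x)\<^sup>2 \<partial>M)"
proof -
  have [measurable]: "U \<in> borel_measurable M" "V \<in> borel_measurable M"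
    using U V by (auto simp: square_integrable_def)
  have "ennreal ((\<integral>x. \<bar>U x * V x\<bar> \<partial>M)\<^sup>2) = (\<integral>\<^sup>+x. ennreal \<bar>U x\<bar> * ennreal \<bar>V x\<bar> \<partial>M)\<^sup>2"
    using nn_integral_eq_integral[OF integrable_abs[OF square_integrable_mult[OF U V]]]
    by (simp add: abs_mult ennreal_mult flip: ennreal_power)
  also have "\<dots> \<le> (\<integral>\<^sup>+x. (ennreal \<bar>U x\<bar>)\<^sup>2 \<partial>M) * (\<integral>\<^sup>+x. (ennreal \<bar>V x\<bar>)\<^sup>2 \<partial>M)"
    by (rule Cauchy_Schwarz_nn_integral) auto
  also have "\<dots> = ennreal ((\<integral>x. (U x)\<^sup>2 \<partial>M) * (\<integral>x. (V x)\<^sup>2 \<partial>M))"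
    using U V by (simp add: square_integrable_def ennreal_power nn_integral_eq_integral ennreal_mult)
  finally have "(\<integral>x. \<bar>U x * V x\<bar> \<partial>M)\<^sup>2 \<le> (\<integral>x. (U x)\<^sup>2 \<partial>M) * (\<integral>x. (V x)\<^sup>2 \<partial>M)"
    by (simp add: ennreal_le_iff)
  then have "\<bar>\<integral>x. \<bar>U x * V x\<bar> \<partial>M\<bar> \<le> sqrt ((\<integral>x. (U x)\<^sup>2 \<partial>M) * (\<integral>x. (V x)\<^sup>2 \<partial>M))"
    by (simp add: real_le_rsqrt)
  then have "(\<integral>x. \<bar>U x * V x\<bar> \<partial>M) \<le> sqrt (\<integral>x. (U x)\<^sup>2 \<partial>M) * sqrt (\<integral>x. (V x)\<^sup>2 \<partial>M)"
    by (simp add: real_sqrt_mult)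
  with integral_abs_bound[of M "\<lambda>x. U x * V x"] show ?thesis
    by (rule order_trans)
qed

definition mean_square_limit :: "'a measure \<Rightarrow> (nat \<Rightarrow> 'a \<Rightarrow> real) \<Rightarrow> ('a \<Rightarrow> real) \<Rightarrow> bool" where
  "mean_square_limit M X Y \<longleftrightarrow> (\<forall>m. square_integrable M (X m)) \<and> square_integrable M Y \<and>
     (\<lambda>m. \<integral>x. (X m x - Y x)\<^sup>2 \<partial>M) \<longlonglongrightarrow> 0"

text \<open>
  One finite distance to a square-integrable function already makes the limit square-integrable.
\<close>

lemma mean_square_limitI:
  assumes X: "\<And>m. square_integrable M (X m)" and Y [measurable]: "Y \<in> borel_measurable M"
    and lim: "(\<lambda>m. \<integral>\<^sup>+x. ennreal ((X m x - Y x)\<^sup>2) \<partial>M) \<longlonglongrightarrow> 0"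
  shows "mean_square_limit M X Y"
proof -
  have [measurable]: "X m \<in> borel_measurable M" for m
    using X[of m] by (simp add: square_integrable_def)
  have "\<forall>\<^sub>F m in sequentially. (\<integral>\<^sup>+x. ennreal ((X m x - Y x)\<^sup>2) \<partial>M) < 1"
    using order_tendstoD(2)[OF lim, of 1] by simp
  then obtain m where "(\<integral>\<^sup>+x. ennreal ((X m x - Y x)\<^sup>2) \<partial>M) < 1"
    by (auto dest: eventually_happens)
  then have "square_integrable M (\<lambda>x. X m x - Y x)"
    unfolding square_integrable_def by (auto intro!: integrableI_nonneg intro: less_trans)
  from square_integrable_diff[OF X[of m] this] have sqY: "square_integrable M Y" by simp
  have "(\<integral>\<^sup>+x. ennreal ((X m x - Y x)\<^sup>2) \<partial>M) = ennreal (\<integral>x. (X m x - Y x)\<^sup>2 \<partial>M)" for m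
    using square_integrable_diff[OF X[of m] sqY]
    by (intro nn_integral_eq_integral) (auto simp: square_integrable_def)
  with lim have "(\<lambda>m. \<integral>x. (X m x - Y x)\<^sup>2 \<partial>M) \<longlonglongrightarrow> 0"
    by (simp add: ennreal_tendsto_0_iff)
  then show ?thesis using X sqY by (simp add: mean_square_limit_def)
qed

lemma mean_square_limit_const: "square_integrable M Y \<Longrightarrow> mean_square_limit M (\<lambda>_. Y) Y"
  by (simp add: mean_square_limit_def)

lemma mean_square_limit_inner:
  assumes U: "mean_square_limit M U X" and V: "mean_square_limit M V Y"
  shows "(\<lambda>m. \<integral>x. U m x * V m x \<partial>M) \<longlonglongrightarrow> (\<integral>x. X x * Y x \<partial>M)"
proof -
  have sq: "square_integrable M (U m)" "square_integrable M (V m)" "square_integrable M X" "square_integrable M Y" for m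
    using U V by (auto simp: mean_square_limit_def)
  define u where "u m x = U m x - X x" for m x
  define v where "v m x = V m x - Y x" for m x
  have squ: "square_integrable M (u m)" "square_integrable M (v m)" for m
    unfolding u_def v_def by (intro square_integrable_diff sq)+
  have nu: "(\<lambda>m. sqrt (\<integral>x. (u m x)\<^sup>2 \<partial>M)) \<longlonglongrightarrow> 0" and nv: "(\<lambda>m. sqrt (\<integral>x. (v m x)\<^sup>2 \<partial>M)) \<longlonglongrightarrow> 0"
    using U V tendsto_real_sqrt[of _ 0] by (auto simp: mean_square_limit_def u_def v_def)
  have inner0: "(\<lambda>m. \<integral>x. F m x * G m x \<partial>M) \<longlonglongrightarrow> 0"
    if "\<And>m. square_integrable M (F m)" "\<And>m. square_integrable M (G m)"
      "(\<lambda>m. sqrt (\<integral>x. (F m x)\<^sup>2 \<partial>M) * sqrt (\<integral>x. (G m x)\<^sup>2 \<partial>M)) \<longlonglongrightarrow> 0" for F G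
    using that(3) by (rule Lim_null_comparison[rotated])
      (use Cauchy_Schwarz_integral[OF that(1,2)] in \<open>auto intro!: always_eventually\<close>)
  have "(\<lambda>m. (\<integral>x. u m x * Y x \<partial>M) + (\<integral>x. X x * v m x \<partial>M) + (\<integral>x. u m x * v m x \<partial>M)
      + (\<integral>x. X x * Y x \<partial>M)) \<longlonglongrightarrow> 0 + 0 + 0 + (\<integral>x. X x * Y x \<partial>M)"
    by (intro tendsto_add inner0 squ sq tendsto_const tendsto_mult_left_zero[OF nu]
        tendsto_mult_right_zero[OF nv] tendsto_mult_zero[OF nu nv])
  moreover have "(\<integral>x. U m x * V m x \<partial>M) = (\<integral>x. u m x * Y x \<partial>M) + (\<integral>x. X x * v m x \<partial>M)
      + (\<integral>x. u m x * v m x \<partial>M) + (\<integral>x. X x * Y x \<partial>M)" for m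
  proof -
    have "U m x * V m x = u m x * Y x + X x * v m x + u m x * v m x + X x * Y x" for x
      by (simp add: u_def v_def algebra_simps)
    then show ?thesis
      by (simp only:) (intro integral_sum_of_four square_integrable_mult sq squ)
  qed
  ultimately show ?thesis by simp
qed

section \<open>Lebesgue measure on the unit interval\<close>

definition unit_interval :: "real measure" where
  "unit_interval = restrict_space lborel {0..1}"

lemma space_unit_interval [simp]: "space unit_interval = {0..1}"
  by (simp add: unit_interval_def space_restrict_space)

lemma prob_space_unit_interval: "prob_space unit_interval"
  unfolding unit_interval_def by (rule prob_space_restrict_space) auto

lemma measurable_unit_interval:
  "f \<in> borel_measurable borel \<Longrightarrow> f \<in> borel_measurable unit_interval"
  unfolding unit_interval_def by (rule measurable_restrict_space1) simp

lemma integral_indicator_unit_interval: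
  assumes "0 \<le> a" "b \<le> 1"
  shows "(\<integral>s. indicator {a<..b} s \<partial>unit_interval) = (max 0 (b - a) :: real)"
proof -
  have "(\<integral>s. indicator {a<..b} s \<partial>unit_interval) = (\<integral>s. indicator ({0..1} \<inter> {a<..b}) s \<partial>lborel :: real)"
    unfolding unit_interval_def by (subst integral_restrict_space) (simp, simp only: indicator_inter_arith[abs_def] real_scaleR_def)
  also have "{0..1} \<inter> {a<..b} = {a<..b}" using assms by auto
  finally show ?thesis by (cases "a \<le> b") (auto simp: max_def)
qed

lemma integral_linear_unit_interval: "(\<integral>s. s * c \<partial>unit_interval) = (c / 2 :: real)"
proof -
  have "(\<integral>s. s * c \<partial>unit_interval) = (\<integral>s. c * (s ^ 1 * indicator {0..1} s) \<partial>lborel)"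
    unfolding unit_interval_def by (subst integral_restrict_space) (auto simp: mult_ac)
  also have "\<dots> = c * ((1 ^ Suc 1 - 0 ^ Suc 1) / Suc 1)"
    by (subst integral_mult_right_zero) (subst integral_power, simp_all)
  finally show ?thesis by simp
qed

lemma integrable_unit_interval_bounded:
  fixes f :: "real \<Rightarrow> real"
  assumes "f \<in> borel_measurable unit_interval" "\<And>s. s \<in> {0..1} \<Longrightarrow> \<bar>f s\<bar> \<le> c"
  shows "integrable unit_interval f"
proof -
  interpret prob_space unit_interval by (rule prob_space_unit_interval)
  show ?thesis by (rule integrable_const_bound[where B=c]) (use assms in \<open>auto intro!: AE_I2\<close>)
qed

section \<open>Moments of the Ito integral of one coordinate against another\<close>

lemma all_moments_sum:
  assumes "finite_measure M" "\<And>k. k \<in> A \<Longrightarrow> all_moments M (X k)"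
  shows "all_moments M (\<lambda>\<omega>. \<Sum>k\<in>A. X k \<omega>)"
proof -
  interpret finite_measure M by fact
  show ?thesis
    using assms(2)
    by (induction A rule: infinite_finite_induct) (auto intro: all_moments_const all_moments_add)
qed

lemma integral_product_of_sums:
  fixes f g :: "nat \<Rightarrow> 'a \<Rightarrow> real"
  assumes "\<And>k l. k \<in> A \<Longrightarrow> l \<in> A' \<Longrightarrow> integrable M (\<lambda>x. f k x * g l x)"
  shows "(\<integral>x. (\<Sum>k\<in>A. f k x) * (\<Sum>l\<in>A'. g l x) \<partial>M) = (\<Sum>k\<in>A. \<Sum>l\<in>A'. \<integral>x. f k x * g l x \<partial>M)"
  using assms by (simp add: sum_product)

context brownian_motion
begin

sublocale Q: pair_prob_space unit_interval M
  by (simp add: pair_prob_space_def pair_sigma_finite_def prob_space_unit_interval prob_space_axioms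
      prob_space_imp_sigma_finite)

abbreviation time_paths :: "(real \<times> 'a) measure" where
  "time_paths \<equiv> unit_interval \<Otimes>\<^sub>M M"

lemma measurable_fst_time_paths [measurable]: "fst \<in> borel_measurable time_paths"
  by (rule measurable_compose[OF measurable_fst measurable_unit_interval]) simp

lemma integral_time_paths_product:
  fixes f :: "real \<Rightarrow> real" and g :: "'a \<Rightarrow> real"
  assumes f [measurable]: "f \<in> borel_measurable unit_interval" and g: "integrable M g"
    and "\<And>s. s \<in> {0..1} \<Longrightarrow> \<bar>f s\<bar> \<le> c"
  shows "(\<integral>z. f (fst z) * g (snd z) \<partial>time_paths) = (\<integral>s. f s \<partial>unit_interval) * (\<integral>\<omega>. g \<omega> \<partial>M)"
proof -
  have [measurable]: "g \<in> borel_measurable M" using g by auto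
  have intf: "integrable unit_interval f"
    by (rule integrable_unit_interval_bounded[where c=c]) (use assms in auto)
  have "integrable time_paths (\<lambda>z. f (fst z) * g (snd z))"
    using g intf
    by (intro Q.Fubini_integrable) (auto simp: abs_mult)
  from Q.integral_fst'[OF this] show ?thesis by simp
qed

text \<open>
  By continuity, a path is the limit of its values at the grid points \<open>\<lfloor>m t\<rfloor> / m\<close> with \<open>m = n + 1\<close>; the
  approximations are jointly measurable, as they take countably many times into account.
\<close>

lemma measurable_B_time_paths [measurable]: "(\<lambda>z. B (fst z) (snd z) $ i) \<in> borel_measurable time_paths"
proof (rule borel_measurable_LIMSEQ_real)
  fix n :: nat
  show "(\<lambda>z. B (real (nat \<lfloor>real (Suc n) * fst z\<rfloor>) / real (Suc n)) (snd z) $ i) \<in> borel_measurable time_paths"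
  proof (rule measurable_compose_countable[where g = "\<lambda>z. nat \<lfloor>real (Suc n) * fst z\<rfloor>"])
    fix k :: nat
    have [measurable]: "B (real k / real (Suc n)) \<in> borel_measurable M" by (rule measurable_B) simp
    show "(\<lambda>z. B (real k / real (Suc n)) (snd z) $ i) \<in> borel_measurable time_paths"
      by (intro borel_measurable_nth measurable_compose[OF measurable_snd]) measurable
  qed measurable
next
  fix z assume "z \<in> space time_paths"
  then have z: "fst z \<ge> 0" "snd z \<in> space M" by (auto simp: space_pair_measure)
  let ?t = "\<lambda>n. real (nat \<lfloor>real (Suc n) * fst z\<rfloor>) / real (Suc n)"
  have "?t \<longlonglongrightarrow> fst z"
  proof (rule tendsto_sandwich[of "\<lambda>n. fst z - 1 / real (Suc n)" _ _ "\<lambda>_. fst z"])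
    have "(real (Suc n) * fst z - 1) / real (Suc n) \<le> ?t n" for n
      using z by (intro divide_right_mono) linarith+
    then show "\<forall>\<^sub>F n in sequentially. fst z - 1 / real (Suc n) \<le> ?t n"
      by (intro always_eventually allI) (simp add: diff_divide_distrib del: of_nat_Suc)
    have "?t n \<le> real (Suc n) * fst z / real (Suc n)" for n
      using z by (intro divide_right_mono) (simp_all add: of_nat_nat)
    then show "\<forall>\<^sub>F n in sequentially. ?t n \<le> fst z"
      by (intro always_eventually allI) (simp del: of_nat_Suc)
    show "(\<lambda>n. fst z - 1 / real (Suc n)) \<longlonglongrightarrow> fst z"
      using tendsto_diff[OF tendsto_const LIMSEQ_inverse_real_of_nat, of "fst z"]
      by (simp add: inverse_eq_divide)
  qed simp
  then have "(\<lambda>n. B (?t n) (snd z)) \<longlonglongrightarrow> B (fst z) (snd z)"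
    using continuous_paths[OF z(2)] z(1)
    by (auto simp: continuous_on_sequentially comp_def)
  then show "(\<lambda>n. B (?t n) (snd z) $ i) \<longlonglongrightarrow> B (fst z) (snd z) $ i"
    by (rule tendsto_vec_nth)
qed

lemma B_square_integrable_time_paths: "square_integrable time_paths (\<lambda>z. B (fst z) (snd z) $ i)"
proof -
  have "integrable time_paths (\<lambda>z. (B (fst z) (snd z) $ i)\<^sup>2)"
  proof (rule Q.Fubini_integrable)
    have "(\<integral>\<omega>. norm ((B s \<omega> $ i)\<^sup>2) \<partial>M) = s * S $ i $ i" if "0 \<le> s" for s
      using centred_gaussian.second_moment[OF gaussian_B[OF that], of i i] by (simp add: power2_eq_square)
    then show "integrable unit_interval (\<lambda>s. \<integral>\<omega>. norm ((B (fst (s, \<omega>)) (snd (s, \<omega>)) $ i)\<^sup>2) \<partial>M)"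
      by (intro integrable_unit_interval_bounded[where c="\<bar>S $ i $ i\<bar>"])
        (auto simp: abs_mult mult_left_le_one_le cong: measurable_cong)
    have "integrable M (\<lambda>\<omega>. (B s \<omega> $ i)\<^sup>2)" if "0 \<le> s" for s
      using centred_gaussian.moments_nth[OF gaussian_B[OF that], of i] by (rule all_moments_power_integrable)
    then show "AE s in unit_interval. integrable M (\<lambda>\<omega>. (B (fst (s, \<omega>)) (snd (s, \<omega>)) $ i)\<^sup>2)"
      by (intro AE_I2) simp
  qed measurable
  then show ?thesis by (simp add: square_integrable_def)
qed

lemma inner_B_time_paths:
  "(\<integral>z. B (fst z) (snd z) $ i * B (fst z) (snd z) $ j \<partial>time_paths) = S $ i $ j / 2"
proof -
  have "(\<integral>z. B (fst z) (snd z) $ i * B (fst z) (snd z) $ j \<partial>time_paths)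
    = (\<integral>s. (\<integral>\<omega>. B s \<omega> $ i * B s \<omega> $ j \<partial>M) \<partial>unit_interval)"
    using Q.integral_fst'[OF square_integrable_mult[OF B_square_integrable_time_paths B_square_integrable_time_paths], of i j]
    by simp
  also have "\<dots> = (\<integral>s. s * S $ i $ j \<partial>unit_interval)"
    by (rule Bochner_Integration.integral_cong)
      (auto simp: centred_gaussian.second_moment[OF gaussian_B])
  finally show ?thesis by (simp only: integral_linear_unit_interval)
qed

definition step :: "('a \<Rightarrow> real) \<Rightarrow> real \<Rightarrow> real \<Rightarrow> real \<times> 'a \<Rightarrow> real" where
  "step \<xi> a b z = indicator {a<..b} (fst z) * \<xi> (snd z)"

lemma step_all_moments:
  assumes [measurable]: "\<xi> \<in> borel_measurable M" and "\<And>\<omega>. \<omega> \<in> space M \<Longrightarrow> \<bar>\<xi> \<omega>\<bar> \<le> c"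
  shows "all_moments time_paths (step \<xi> a b)"
proof (rule Q.all_moments_bounded)
  show "step \<xi> a b \<in> borel_measurable time_paths"
    unfolding step_def by measurable
  show "\<bar>step \<xi> a b z\<bar> \<le> \<bar>c\<bar>" if "z \<in> space time_paths" for z
    using assms(2)[of "snd z"] that
    by (auto simp: step_def space_pair_measure split: split_indicator)
qed

lemma inner_step_step:
  assumes "0 \<le> a" "b \<le> 1" "0 \<le> c" "d \<le> 1" "integrable M (\<lambda>\<omega>. \<xi> \<omega> * \<eta> \<omega>)"
  shows "(\<integral>z. step \<xi> a b z * step \<eta> c d z \<partial>time_paths)
    = (\<integral>\<omega>. \<xi> \<omega> * \<eta> \<omega> \<partial>M) * max 0 (min b d - max a c)"
proof -
  have "step \<xi> a b z * step \<eta> c d z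
      = indicator {max a c<..min b d} (fst z) * (\<xi> (snd z) * \<eta> (snd z))" for z
    by (auto simp: step_def split: split_indicator)
  then have "(\<integral>z. step \<xi> a b z * step \<eta> c d z \<partial>time_paths)
      = (\<integral>z. indicator {max a c<..min b d} (fst z) * (\<xi> (snd z) * \<eta> (snd z)) \<partial>time_paths)"
    by (simp only:)
  also have "\<dots> = (\<integral>s. indicator {max a c<..min b d} s \<partial>unit_interval) * (\<integral>\<omega>. \<xi> \<omega> * \<eta> \<omega> \<partial>M)"
    by (rule integral_time_paths_product[where c=1])
      (auto intro!: measurable_unit_interval assms split: split_indicator)
  also have "(\<integral>s. indicator {max a c<..min b d} s \<partial>unit_interval) = max 0 (min b d - max a c)"
    using assms by (intro integral_indicator_unit_interval) auto
  finally show ?thesis by (simp only: mult.commute)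
qed

text \<open>
  For \<open>s > a\<close> the coefficient does not see the increment from \<open>a\<close> to \<open>s\<close>, so the value at time \<open>s\<close> may
  be replaced by the one at the left end of the step.
\<close>

lemma inner_step_B:
  assumes "0 \<le> a" "a \<le> b" "b \<le> 1" and \<xi>: "known_at a \<xi>"
    and bounded: "\<And>\<omega>. \<omega> \<in> space M \<Longrightarrow> \<bar>\<xi> \<omega>\<bar> \<le> c"
  shows "(\<integral>z. step \<xi> a b z * B (fst z) (snd z) $ i \<partial>time_paths)
    = (b - a) * (\<integral>\<omega>. \<xi> \<omega> * B a \<omega> $ i \<partial>M)"
proof -
  have "\<xi> \<in> borel_measurable M"
    using \<xi> by (auto simp: known_at_def all_moments_def)
  from square_integrable_of_all_moments[OF step_all_moments[OF this bounded]]
  have int: "integrable time_paths (\<lambda>z. step \<xi> a b z * B (fst z) (snd z) $ i)"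
    by (intro square_integrable_mult B_square_integrable_time_paths)
  have "(\<integral>z. step \<xi> a b z * B (fst z) (snd z) $ i \<partial>time_paths)
    = (\<integral>s. (\<integral>\<omega>. indicator {a<..b} s * (\<xi> \<omega> * B s \<omega> $ i) \<partial>M) \<partial>unit_interval)"
    using Q.integral_fst'[OF int] by (simp add: step_def mult.assoc)
  also have "\<dots> = (\<integral>s. indicator {a<..b} s * (\<integral>\<omega>. \<xi> \<omega> * B a \<omega> $ i \<partial>M) \<partial>unit_interval)"
  proof (rule Bochner_Integration.integral_cong)
    fix s
    show "(\<integral>\<omega>. indicator {a<..b} s * (\<xi> \<omega> * B s \<omega> $ i) \<partial>M)
      = indicator {a<..b} s * (\<integral>\<omega>. \<xi> \<omega> * B a \<omega> $ i \<partial>M)"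
    proof (cases "s \<in> {a<..b}")
      case True
      then show ?thesis
        using past_times_B[OF assms(1) _ \<xi>, of s i] by simp
    qed simp
  qed simp
  also have "\<dots> = (b - a) * (\<integral>\<omega>. \<xi> \<omega> * B a \<omega> $ i \<partial>M)"
    using integral_indicator_unit_interval[OF assms(1,3)] assms(2)
    by (simp only: integral_mult_left_zero diff_ge_0_iff_ge max_absorb2)
  finally show ?thesis .
qed

lemma simple_process_knots:
  assumes "simple_process M past 1 n \<tau> \<xi>" "k < n"
  shows "0 \<le> \<tau> k" "\<tau> k \<le> \<tau> (Suc k)" "\<tau> (Suc k) \<le> 1"
proof -
  have step: "\<tau> l \<le> \<tau> (Suc l)" if "l < n" for l
    using assms(1) that by (auto simp: simple_process_def intro: less_imp_le)
  have mono: "\<tau> l \<le> \<tau> m" if "l \<le> m" "m \<le> n" for l m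
    using that by (induction m rule: dec_induct) (auto intro: order_trans[OF _ step])
  show "0 \<le> \<tau> k" "\<tau> k \<le> \<tau> (Suc k)" "\<tau> (Suc k) \<le> 1"
    using mono[of 0 k] mono[of k "Suc k"] mono[of "Suc k" n] assms by (auto simp: simple_process_def)
qed

lemma simple_process_coefficients:
  assumes "simple_process M past 1 n \<tau> \<xi>" "k < n"
  shows "\<exists>c. \<forall>\<omega>\<in>space M. \<bar>\<xi> k \<omega>\<bar> \<le> c" "known_at (\<tau> k) (\<xi> k)"
proof -
  show "\<exists>c. \<forall>\<omega>\<in>space M. \<bar>\<xi> k \<omega>\<bar> \<le> c"
    using assms by (auto simp: simple_process_def)
  then obtain c where c: "\<And>\<omega>. \<omega> \<in> space M \<Longrightarrow> \<bar>\<xi> k \<omega>\<bar> \<le> c" by auto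
  have "\<xi> k \<in> borel_measurable (past (\<tau> k))"
    using assms by (auto simp: simple_process_def)
  then show "known_at (\<tau> k) (\<xi> k)"
    unfolding known_at_def using all_moments_bounded[OF measurable_past c] by auto
qed

lemma simple_value_eq_steps:
  "simple_value n \<tau> \<xi> (fst z) (snd z) = (\<Sum>k<n. step (\<xi> k) (\<tau> k) (\<tau> (Suc k)) z)"
  by (simp add: simple_value_def step_def mult.commute)

lemma simple_integral_eq_incr:
  "simple_integral n \<tau> \<xi> (\<lambda>t \<omega>. B t \<omega> $ i) \<omega> = (\<Sum>k<n. \<xi> k \<omega> * incr i (\<tau> k) (\<tau> (Suc k)) \<omega>)"
  by (simp add: simple_integral_def incr_def)

lemma simple_process_terms:
  assumes "simple_process M past 1 n \<tau> \<xi>" "k < n"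
  shows "all_moments time_paths (step (\<xi> k) (\<tau> k) (\<tau> (Suc k)))"
    and "all_moments M (\<lambda>\<omega>. \<xi> k \<omega> * incr i (\<tau> k) (\<tau> (Suc k)) \<omega>)"
proof -
  note knots = simple_process_knots[OF assms] and coeff = simple_process_coefficients[OF assms]
  obtain c where "\<And>\<omega>. \<omega> \<in> space M \<Longrightarrow> \<bar>\<xi> k \<omega>\<bar> \<le> c" using coeff(1) by auto
  moreover have "\<xi> k \<in> borel_measurable M" using coeff(2) by (auto simp: known_at_def all_moments_def)
  ultimately show "all_moments time_paths (step (\<xi> k) (\<tau> k) (\<tau> (Suc k)))"
    by (intro step_all_moments)
  have "known_at 1 (\<lambda>\<omega>. \<xi> k \<omega> * incr i (\<tau> k) (\<tau> (Suc k)) \<omega>)"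
    using knots by (intro known_at_mult known_at_incr known_at_mono[OF coeff(2)]) auto
  then show "all_moments M (\<lambda>\<omega>. \<xi> k \<omega> * incr i (\<tau> k) (\<tau> (Suc k)) \<omega>)"
    by (simp add: known_at_def)
qed

lemma simple_value_all_moments:
  assumes "simple_process M past 1 n \<tau> \<xi>"
  shows "all_moments time_paths (\<lambda>z. simple_value n \<tau> \<xi> (fst z) (snd z))"
  unfolding simple_value_eq_steps
  by (intro all_moments_sum Q.finite_measure_axioms simple_process_terms[OF assms]) simp

lemma simple_integral_all_moments:
  assumes "simple_process M past 1 n \<tau> \<xi>"
  shows "all_moments M (simple_integral n \<tau> \<xi> (\<lambda>t \<omega>. B t \<omega> $ i))"
  unfolding simple_integral_eq_incr[abs_def]
  by (intro all_moments_sum finite_measure_axioms simple_process_terms[OF assms]) simp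

lemma simple_integral_mean:
  assumes "simple_process M past 1 n \<tau> \<xi>"
  shows "(\<integral>\<omega>. simple_integral n \<tau> \<xi> (\<lambda>t \<omega>. B t \<omega> $ i) \<omega> \<partial>M) = 0"
proof -
  have "(\<integral>\<omega>. \<xi> k \<omega> * incr i (\<tau> k) (\<tau> (Suc k)) \<omega> \<partial>M) = 0" if "k < n" for k
    using simple_process_knots[OF assms that] simple_process_coefficients[OF assms that]
    by (intro past_times_incr(1))
  then show ?thesis
    unfolding simple_integral_eq_incr
    by (subst Bochner_Integration.integral_sum)
      (auto intro: all_moments_integrable simple_process_terms[OF assms])
qed

text \<open>
  The two processes have unrelated partitions. Since the isometry for single steps allows arbitrarily
  overlapping intervals, no common refinement is needed.
\<close>

lemma simple_integral_isometry:
  assumes \<xi>: "simple_process M past 1 n \<tau> \<xi>" and \<eta>: "simple_process M past 1 m \<upsilon> \<eta>"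
  shows "(\<integral>\<omega>. simple_integral n \<tau> \<xi> (\<lambda>t \<omega>. B t \<omega> $ i) \<omega> * simple_integral m \<upsilon> \<eta> (\<lambda>t \<omega>. B t \<omega> $ j) \<omega> \<partial>M)
    = S $ i $ j * (\<integral>z. simple_value n \<tau> \<xi> (fst z) (snd z) * simple_value m \<upsilon> \<eta> (fst z) (snd z) \<partial>time_paths)"
proof -
  have *: "(\<integral>\<omega>. (\<xi> k \<omega> * incr i (\<tau> k) (\<tau> (Suc k)) \<omega>) * (\<eta> l \<omega> * incr j (\<upsilon> l) (\<upsilon> (Suc l)) \<omega>) \<partial>M)
      = S $ i $ j * (\<integral>z. step (\<xi> k) (\<tau> k) (\<tau> (Suc k)) z * step (\<eta> l) (\<upsilon> l) (\<upsilon> (Suc l)) z \<partial>time_paths)"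
    if "k < n" "l < m" for k l
  proof -
    note k = simple_process_knots[OF \<xi> that(1)] simple_process_coefficients(2)[OF \<xi> that(1)]
    note l = simple_process_knots[OF \<eta> that(2)] simple_process_coefficients(2)[OF \<eta> that(2)]
    have "integrable M (\<lambda>\<omega>. \<xi> k \<omega> * \<eta> l \<omega>)"
      using k l by (intro all_moments_integrable all_moments_mult) (auto simp: known_at_def)
    then show ?thesis
      using k l by (simp add: elementary_isometry inner_step_step)
  qed
  have "(\<integral>\<omega>. simple_integral n \<tau> \<xi> (\<lambda>t \<omega>. B t \<omega> $ i) \<omega> * simple_integral m \<upsilon> \<eta> (\<lambda>t \<omega>. B t \<omega> $ j) \<omega> \<partial>M)
    = (\<Sum>k<n. \<Sum>l<m. \<integral>\<omega>. (\<xi> k \<omega> * incr i (\<tau> k) (\<tau> (Suc k)) \<omega>) * (\<eta> l \<omega> * incr j (\<upsilon> l) (\<upsilon> (Suc l)) \<omega>) \<partial>M)"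
    unfolding simple_integral_eq_incr
    by (intro integral_product_of_sums all_moments_integrable all_moments_mult
        simple_process_terms[OF \<xi>] simple_process_terms[OF \<eta>]) auto
  also have "\<dots> = (\<Sum>k<n. \<Sum>l<m. S $ i $ j *
      (\<integral>z. step (\<xi> k) (\<tau> k) (\<tau> (Suc k)) z * step (\<eta> l) (\<upsilon> l) (\<upsilon> (Suc l)) z \<partial>time_paths))"
    by (intro sum.cong refl *) auto
  also have "\<dots> = S $ i $ j * (\<integral>z. simple_value n \<tau> \<xi> (fst z) (snd z) * simple_value m \<upsilon> \<eta> (fst z) (snd z) \<partial>time_paths)"
    unfolding simple_value_eq_steps sum_distrib_left[symmetric]
    by (intro arg_cong2[where f = "(*)"] refl integral_product_of_sums[symmetric] all_moments_integrable
        all_moments_mult simple_process_terms[OF \<xi>] simple_process_terms[OF \<eta>]) auto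
  finally show ?thesis .
qed

text \<open>
  The factors \<open>\<integral> \<xi> \<omega> * B a \<omega> $ j\<close> from a single step, weighted by the length of the step, are inner
  products with \<open>B\<close>. This form is continuous in the integrand and hence passes to the limit.
\<close>

lemma simple_integral_times_product:
  assumes \<xi>: "simple_process M past 1 n \<tau> \<xi>"
  shows "(\<integral>\<omega>. simple_integral n \<tau> \<xi> (\<lambda>t \<omega>. B t \<omega> $ i) \<omega> * (B 1 \<omega> $ j * B 1 \<omega> $ k) \<partial>M)
    = S $ i $ k * (\<integral>z. simple_value n \<tau> \<xi> (fst z) (snd z) * B (fst z) (snd z) $ j \<partial>time_paths)
    + S $ i $ j * (\<integral>z. simple_value n \<tau> \<xi> (fst z) (snd z) * B (fst z) (snd z) $ k \<partial>time_paths)"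
proof -
  have *: "(\<integral>\<omega>. (\<xi> l \<omega> * incr i (\<tau> l) (\<tau> (Suc l)) \<omega>) * (B 1 \<omega> $ j * B 1 \<omega> $ k) \<partial>M)
    = S $ i $ k * (\<integral>z. step (\<xi> l) (\<tau> l) (\<tau> (Suc l)) z * B (fst z) (snd z) $ j \<partial>time_paths)
    + S $ i $ j * (\<integral>z. step (\<xi> l) (\<tau> l) (\<tau> (Suc l)) z * B (fst z) (snd z) $ k \<partial>time_paths)"
    if "l < n" for l
  proof -
    note l = simple_process_knots[OF \<xi> that] simple_process_coefficients(2)[OF \<xi> that]
    from simple_process_coefficients(1)[OF \<xi> that]
    obtain c where c: "\<And>\<omega>. \<omega> \<in> space M \<Longrightarrow> \<bar>\<xi> l \<omega>\<bar> \<le> c" by auto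
    have inner: "(\<integral>z. step (\<xi> l) (\<tau> l) (\<tau> (Suc l)) z * B (fst z) (snd z) $ e \<partial>time_paths)
      = (\<tau> (Suc l) - \<tau> l) * (\<integral>\<omega>. \<xi> l \<omega> * B (\<tau> l) \<omega> $ e \<partial>M)" for e
      by (rule inner_step_B[OF l c])
    show ?thesis
      unfolding elementary_integral_times_product[OF l] inner
      by (simp add: algebra_simps)
  qed
  have BB: "all_moments M (\<lambda>\<omega>. B 1 \<omega> $ j * B 1 \<omega> $ k)"
    by (intro all_moments_mult centred_gaussian.moments_nth[OF gaussian_B]) auto
  have int: "integrable time_paths (\<lambda>z. step (\<xi> l) (\<tau> l) (\<tau> (Suc l)) z * B (fst z) (snd z) $ e)" if "l < n" for l e
    by (intro square_integrable_mult B_square_integrable_time_paths square_integrable_of_all_moments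
        simple_process_terms[OF \<xi>] that)
  have "(\<integral>\<omega>. simple_integral n \<tau> \<xi> (\<lambda>t \<omega>. B t \<omega> $ i) \<omega> * (B 1 \<omega> $ j * B 1 \<omega> $ k) \<partial>M)
    = (\<Sum>l<n. \<integral>\<omega>. (\<xi> l \<omega> * incr i (\<tau> l) (\<tau> (Suc l)) \<omega>) * (B 1 \<omega> $ j * B 1 \<omega> $ k) \<partial>M)"
    unfolding simple_integral_eq_incr sum_distrib_right
    by (rule Bochner_Integration.integral_sum)
      (auto intro!: all_moments_integrable all_moments_mult[OF _ BB] simple_process_terms[OF \<xi>])
  also have "\<dots> = (\<Sum>l<n. S $ i $ k * (\<integral>z. step (\<xi> l) (\<tau> l) (\<tau> (Suc l)) z * B (fst z) (snd z) $ j \<partial>time_paths)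
    + S $ i $ j * (\<integral>z. step (\<xi> l) (\<tau> l) (\<tau> (Suc l)) z * B (fst z) (snd z) $ k \<partial>time_paths))"
    by (intro sum.cong refl *) auto
  also have "\<dots> = S $ i $ k * (\<integral>z. simple_value n \<tau> \<xi> (fst z) (snd z) * B (fst z) (snd z) $ j \<partial>time_paths)
    + S $ i $ j * (\<integral>z. simple_value n \<tau> \<xi> (fst z) (snd z) * B (fst z) (snd z) $ k \<partial>time_paths)"
    unfolding simple_value_eq_steps sum_distrib_right sum.distrib sum_distrib_left[symmetric]
    using int by (simp add: Bochner_Integration.integral_sum)
  finally show ?thesis .
qed

end

context brownian_motion
begin

text \<open>
  The iterated integral that measures the distance to the integrand is an integral over the product
  space by Tonelli's theorem.
\<close>

lemma ito_integral_approximation: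
  assumes "has_ito_integral M past (\<lambda>t \<omega>. B t \<omega> $ i) 1 (\<lambda>t \<omega>. B t \<omega> $ h) J"
  obtains n \<tau> \<xi> where "\<And>m. simple_process M past 1 (n m) (\<tau> m) (\<xi> m)"
    and "mean_square_limit time_paths (\<lambda>m z. simple_value (n m) (\<tau> m) (\<xi> m) (fst z) (snd z))
           (\<lambda>z. B (fst z) (snd z) $ h)"
    and "mean_square_limit M (\<lambda>m. simple_integral (n m) (\<tau> m) (\<xi> m) (\<lambda>t \<omega>. B t \<omega> $ i)) J"
proof -
  from assms obtain n \<tau> \<xi> where J: "J \<in> borel_measurable M"
    and sp: "\<And>m. simple_process M past 1 (n m) (\<tau> m) (\<xi> m)"
    and val: "(\<lambda>m. \<integral>\<^sup>+\<omega>. (\<integral>\<^sup>+s\<in>{0..1}. ennreal ((simple_value (n m) (\<tau> m) (\<xi> m) s \<omega> - B s \<omega> $ h)\<^sup>2) \<partial>lborel) \<partial>M)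
          \<longlonglongrightarrow> 0"
    and int: "(\<lambda>m. \<integral>\<^sup>+\<omega>. ennreal ((simple_integral (n m) (\<tau> m) (\<xi> m) (\<lambda>t \<omega>. B t \<omega> $ i) \<omega> - J \<omega>)\<^sup>2) \<partial>M) \<longlonglongrightarrow> 0"
    unfolding has_ito_integral_def by auto
  have "(\<integral>\<^sup>+\<omega>. (\<integral>\<^sup>+s\<in>{0..1}. ennreal ((simple_value (n m) (\<tau> m) (\<xi> m) s \<omega> - B s \<omega> $ h)\<^sup>2) \<partial>lborel) \<partial>M)
    = (\<integral>\<^sup>+z. ennreal ((simple_value (n m) (\<tau> m) (\<xi> m) (fst z) (snd z) - B (fst z) (snd z) $ h)\<^sup>2) \<partial>time_paths)" for m
  proof -
    have [measurable]: "(\<lambda>z. simple_value (n m) (\<tau> m) (\<xi> m) (fst z) (snd z)) \<in> borel_measurable time_paths"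
      by (rule all_moments_measurable[OF simple_value_all_moments[OF sp]])
    have "(\<integral>\<^sup>+\<omega>. (\<integral>\<^sup>+s\<in>{0..1}. ennreal ((simple_value (n m) (\<tau> m) (\<xi> m) s \<omega> - B s \<omega> $ h)\<^sup>2) \<partial>lborel) \<partial>M)
      = (\<integral>\<^sup>+\<omega>. \<integral>\<^sup>+s. ennreal ((simple_value (n m) (\<tau> m) (\<xi> m) s \<omega> - B s \<omega> $ h)\<^sup>2) \<partial>unit_interval \<partial>M)"
      unfolding unit_interval_def by (subst nn_integral_restrict_space) auto
    also have "\<dots> = (\<integral>\<^sup>+z. ennreal ((simple_value (n m) (\<tau> m) (\<xi> m) (fst z) (snd z) - B (fst z) (snd z) $ h)\<^sup>2) \<partial>time_paths)"
      by (subst Q.nn_integral_snd[symmetric]) auto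
    finally show ?thesis .
  qed
  with val have val': "(\<lambda>m. \<integral>\<^sup>+z. ennreal ((simple_value (n m) (\<tau> m) (\<xi> m) (fst z) (snd z) - B (fst z) (snd z) $ h)\<^sup>2) \<partial>time_paths) \<longlonglongrightarrow> 0"
    by simp
  show thesis
  proof (rule that)
    show "mean_square_limit time_paths (\<lambda>m z. simple_value (n m) (\<tau> m) (\<xi> m) (fst z) (snd z))
           (\<lambda>z. B (fst z) (snd z) $ h)"
      by (rule mean_square_limitI[OF _ measurable_B_time_paths val'])
        (rule square_integrable_of_all_moments[OF simple_value_all_moments[OF sp]])
    show "mean_square_limit M (\<lambda>m. simple_integral (n m) (\<tau> m) (\<xi> m) (\<lambda>t \<omega>. B t \<omega> $ i)) J"
      by (rule mean_square_limitI[OF _ J int])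
        (rule square_integrable_of_all_moments[OF simple_integral_all_moments[OF sp]])
  qed (rule sp)
qed

lemma ito_integral_moments:
  assumes J: "has_ito_integral M past (\<lambda>t \<omega>. B t \<omega> $ i) 1 (\<lambda>t \<omega>. B t \<omega> $ h) J"
  shows "square_integrable M J"
    and "(\<integral>\<omega>. J \<omega> \<partial>M) = 0"
    and "(\<integral>\<omega>. J \<omega> * (B 1 \<omega> $ j * B 1 \<omega> $ k) \<partial>M) = (S $ i $ k * S $ h $ j + S $ i $ j * S $ h $ k) / 2"
proof -
  obtain n \<tau> \<xi> where sp: "\<And>m. simple_process M past 1 (n m) (\<tau> m) (\<xi> m)"
    and val: "mean_square_limit time_paths (\<lambda>m z. simple_value (n m) (\<tau> m) (\<xi> m) (fst z) (snd z))
           (\<lambda>z. B (fst z) (snd z) $ h)"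
    and int: "mean_square_limit M (\<lambda>m. simple_integral (n m) (\<tau> m) (\<xi> m) (\<lambda>t \<omega>. B t \<omega> $ i)) J"
    using ito_integral_approximation[OF J] by blast
  show "square_integrable M J" using int by (simp add: mean_square_limit_def)
  have one: "square_integrable M (\<lambda>_. 1)"
    by (rule square_integrable_of_all_moments[OF all_moments_const])
  show "(\<integral>\<omega>. J \<omega> \<partial>M) = 0"
    using mean_square_limit_inner[OF int mean_square_limit_const[OF one]] simple_integral_mean[OF sp]
    by (simp add: LIMSEQ_const_iff)
  have BB: "square_integrable M (\<lambda>\<omega>. B 1 \<omega> $ j * B 1 \<omega> $ k)"
    by (intro square_integrable_of_all_moments all_moments_mult centred_gaussian.moments_nth[OF gaussian_B]) auto
  have inner: "(\<lambda>m. \<integral>z. simple_value (n m) (\<tau> m) (\<xi> m) (fst z) (snd z) * B (fst z) (snd z) $ l \<partial>time_paths)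
      \<longlonglongrightarrow> S $ h $ l / 2" for l
    using mean_square_limit_inner[OF val mean_square_limit_const[OF B_square_integrable_time_paths[of l]]]
    by (simp add: inner_B_time_paths)
  have "(\<lambda>m. \<integral>\<omega>. simple_integral (n m) (\<tau> m) (\<xi> m) (\<lambda>t \<omega>. B t \<omega> $ i) \<omega> * (B 1 \<omega> $ j * B 1 \<omega> $ k) \<partial>M)
      \<longlonglongrightarrow> S $ i $ k * (S $ h $ j / 2) + S $ i $ j * (S $ h $ k / 2)"
    unfolding simple_integral_times_product[OF sp] by (intro tendsto_intros inner)
  from LIMSEQ_unique[OF mean_square_limit_inner[OF int mean_square_limit_const[OF BB]] this]
  show "(\<integral>\<omega>. J \<omega> * (B 1 \<omega> $ j * B 1 \<omega> $ k) \<partial>M) = (S $ i $ k * S $ h $ j + S $ i $ j * S $ h $ k) / 2"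
    by (simp add: add_divide_distrib)
qed

lemma ito_integral_isometry:
  assumes J: "has_ito_integral M past (\<lambda>t \<omega>. B t \<omega> $ i) 1 (\<lambda>t \<omega>. B t \<omega> $ h) J"
    and K: "has_ito_integral M past (\<lambda>t \<omega>. B t \<omega> $ j) 1 (\<lambda>t \<omega>. B t \<omega> $ h) K"
  shows "(\<integral>\<omega>. J \<omega> * K \<omega> \<partial>M) = S $ i $ j * S $ h $ h / 2"
proof -
  obtain n \<tau> \<xi> where sp: "\<And>m. simple_process M past 1 (n m) (\<tau> m) (\<xi> m)"
    and val: "mean_square_limit time_paths (\<lambda>m z. simple_value (n m) (\<tau> m) (\<xi> m) (fst z) (snd z))
           (\<lambda>z. B (fst z) (snd z) $ h)"
    and int: "mean_square_limit M (\<lambda>m. simple_integral (n m) (\<tau> m) (\<xi> m) (\<lambda>t \<omega>. B t \<omega> $ i)) J"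
    using ito_integral_approximation[OF J] by blast
  obtain n' \<tau>' \<xi>' where sp': "\<And>m. simple_process M past 1 (n' m) (\<tau>' m) (\<xi>' m)"
    and val': "mean_square_limit time_paths (\<lambda>m z. simple_value (n' m) (\<tau>' m) (\<xi>' m) (fst z) (snd z))
           (\<lambda>z. B (fst z) (snd z) $ h)"
    and int': "mean_square_limit M (\<lambda>m. simple_integral (n' m) (\<tau>' m) (\<xi>' m) (\<lambda>t \<omega>. B t \<omega> $ j)) K"
    using ito_integral_approximation[OF K] by blast
  have "(\<lambda>m. S $ i $ j * (\<integral>z. simple_value (n m) (\<tau> m) (\<xi> m) (fst z) (snd z)
      * simple_value (n' m) (\<tau>' m) (\<xi>' m) (fst z) (snd z) \<partial>time_paths)) \<longlonglongrightarrow> S $ i $ j * (S $ h $ h / 2)"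
    using mean_square_limit_inner[OF val val'] by (intro tendsto_mult_left) (simp add: inner_B_time_paths)
  then have "(\<lambda>m. \<integral>\<omega>. simple_integral (n m) (\<tau> m) (\<xi> m) (\<lambda>t \<omega>. B t \<omega> $ i) \<omega>
      * simple_integral (n' m) (\<tau>' m) (\<xi>' m) (\<lambda>t \<omega>. B t \<omega> $ j) \<omega> \<partial>M) \<longlonglongrightarrow> S $ i $ j * (S $ h $ h / 2)"
    by (simp only: simple_integral_isometry[OF sp sp'])
  from LIMSEQ_unique[OF mean_square_limit_inner[OF int int'] this] show ?thesis by simp
qed

text \<open>
  The rank-one terms cancel: the product \<open>B\<^sub>h(1) B\<^sub>i(1)\<close> contributes \<open>2 S\<^sub>h\<^sub>i S\<^sub>h\<^sub>j\<close>, the two mixed terms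
  take away \<open>S\<^sub>h\<^sub>i S\<^sub>h\<^sub>j / 2\<close> each, and the product of the means takes away the rest.
\<close>

lemma ito_remainder_covariance:
  assumes J: "has_ito_integral M past (\<lambda>t \<omega>. B t \<omega> $ i) 1 (\<lambda>t \<omega>. B t \<omega> $ h) J"
    and K: "has_ito_integral M past (\<lambda>t \<omega>. B t \<omega> $ j) 1 (\<lambda>t \<omega>. B t \<omega> $ h) K"
  shows "(\<integral>\<omega>. (B 1 \<omega> $ h * B 1 \<omega> $ i - J \<omega> - S $ h $ i) * (B 1 \<omega> $ h * B 1 \<omega> $ j - K \<omega> - S $ h $ j) \<partial>M)
    = S $ h $ h * S $ i $ j / 2" (is ?cov)
    and "(\<integral>\<omega>. B 1 \<omega> $ h * B 1 \<omega> $ i - J \<omega> \<partial>M) = S $ h $ i" (is ?mean)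
proof -
  interpret Z: centred_gaussian M S "B 1"
    using gaussian_B[of 1] by simp
  note sym = S_symmetric[of i h] S_symmetric[of j h] S_symmetric[of j i]
  define P where "P l \<omega> = B 1 \<omega> $ h * B 1 \<omega> $ l" for l \<omega>
  have P: "square_integrable M (P l)" for l
    unfolding P_def by (intro square_integrable_of_all_moments all_moments_mult Z.moments_nth)
  have one: "square_integrable M (\<lambda>_. 1)"
    by (rule square_integrable_of_all_moments[OF all_moments_const])
  note sq = P ito_integral_moments(1)[OF J] ito_integral_moments(1)[OF K] one
  have int1: "integrable M (P l)" "integrable M J" "integrable M K" for l
    using square_integrable_mult[OF P[of l] one] square_integrable_mult[OF sq(2) one]
      square_integrable_mult[OF sq(3) one] by simp_all
  have meanP: "(\<integral>\<omega>. P l \<omega> \<partial>M) = S $ h $ l" for l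
    by (simp add: P_def Z.second_moment)
  show ?mean
    using int1 meanP[of i] ito_integral_moments(2)[OF J] by (simp add: P_def[symmetric])
  have PP: "(\<integral>\<omega>. P i \<omega> * P j \<omega> \<partial>M) = S $ h $ h * S $ i $ j + 2 * (S $ h $ i * S $ h $ j)"
    using Z.fourth_moment[of h i j] by (simp add: P_def power2_eq_square mult_ac)
  have JP: "(\<integral>\<omega>. J \<omega> * P j \<omega> \<partial>M) = (S $ h $ h * S $ i $ j + S $ h $ i * S $ h $ j) / 2"
    using ito_integral_moments(3)[OF J, of h j] sym by (simp add: P_def algebra_simps)
  have KP: "(\<integral>\<omega>. K \<omega> * P i \<omega> \<partial>M) = (S $ h $ h * S $ i $ j + S $ h $ i * S $ h $ j) / 2"
    using ito_integral_moments(3)[OF K, of h i] sym by (simp add: P_def algebra_simps)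
  have "(P i \<omega> - J \<omega> - S $ h $ i) * (P j \<omega> - K \<omega> - S $ h $ j)
    = P i \<omega> * P j \<omega> - J \<omega> * P j \<omega> - K \<omega> * P i \<omega> + J \<omega> * K \<omega>
      - S $ h $ j * (P i \<omega> - J \<omega>) - S $ h $ i * (P j \<omega> - K \<omega>) + S $ h $ i * S $ h $ j" for \<omega>
    by (simp add: algebra_simps)
  then have "(\<integral>\<omega>. (P i \<omega> - J \<omega> - S $ h $ i) * (P j \<omega> - K \<omega> - S $ h $ j) \<partial>M)
    = (\<integral>\<omega>. P i \<omega> * P j \<omega> \<partial>M) - (\<integral>\<omega>. J \<omega> * P j \<omega> \<partial>M) - (\<integral>\<omega>. K \<omega> * P i \<omega> \<partial>M)
      + (\<integral>\<omega>. J \<omega> * K \<omega> \<partial>M) - S $ h $ j * S $ h $ i - S $ h $ i * S $ h $ j + S $ h $ i * S $ h $ j"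
    using int1 meanP ito_integral_moments(2)[OF J] ito_integral_moments(2)[OF K]
    by (simp add: prob_space square_integrable_mult sq)
  then show ?cov
    using ito_integral_isometry[OF J K] PP JP KP by (simp add: P_def algebra_simps)
qed

end

theorem mainTheorem7:
  fixes \<Sigma> :: "real^('d::finite option)^('d option)"
    and M :: "'a measure" and B :: "real \<Rightarrow> 'a \<Rightarrow> real^('d option)"
    and N :: "'b measure" and Z :: "'b \<Rightarrow> real^('d option)"
    and J I :: "'a \<Rightarrow> real^'d"
    and A C :: "real^'d^'d"
  assumes B: "brownian_motion M \<Sigma> B"
    and N: "prob_space N"
    and Z: "mean_zero_normal N \<Sigma> Z"
    and J: "\<And>i. has_ito_integral M (natural_filtration M B) (\<lambda>t \<omega>. B t \<omega> $ Some i) 1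
                 (\<lambda>t \<omega>. B t \<omega> $ None) (\<lambda>\<omega>. J \<omega> $ i)"
    and I: "I = (\<lambda>\<omega>. \<chi> i. B 1 \<omega> $ None * B 1 \<omega> $ Some i - J \<omega> $ i)"
    and A: "A = cov_matrix N (\<lambda>\<omega>. \<chi> i. Z \<omega> $ None * Z \<omega> $ Some i)"
    and C: "C = cov_matrix M I"
    and pos: "positive_definite C"
  shows "det A \<ge> 2 ^ CARD('d) * det C"
proof -
  interpret brownian_motion M \<Sigma> B by fact
  interpret Z: centred_gaussian N \<Sigma> Z
    by (intro centred_gaussian.intro N) (unfold_locales, rule Z)
  define v :: "real^'d" where "v = (\<chi> i. \<Sigma> $ None $ Some i)"
  have C_eq: "C = (\<chi> i j. \<Sigma> $ None $ None * \<Sigma> $ Some i $ Some j / 2)"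
    using ito_remainder_covariance[OF J J] by (simp add: C I cov_matrix_def vec_eq_iff)
  have "A = 2 *\<^sub>R C + outer_product v"
    unfolding A Z.cov_matrix_product C_eq by (simp add: vec_eq_iff outer_product_def v_def)
  moreover have "x \<bullet> ((2 *\<^sub>R C) *v x) > 0" if "x \<noteq> 0" for x
    using pos that by (simp add: positive_definite_def scaleR_matrix_vector_assoc[symmetric])
  ultimately have "det (2 *\<^sub>R C) \<le> det A"
    using det_add_outer[of "2 *\<^sub>R C" v] by simp
  then show ?thesis by (simp add: det_scaleR_matrix)
qed

end
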